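(* Let $0<\lambda\le\Lambda$, let $N\ge2$ be an integer, and let $g:\mathbb{R}\to\mathbb{R}$ satisfy: (g1) $g$ is locally Lipschitz; (g2) $g$ is odd; (g3) there exists $\alpha\in(0,+\infty]$ such that $g$ is positive on $(0,\alpha)$ and negative on $(\alpha,+\infty)$; (g4) $g$ is differentiable at $0$ and $g'(0)>0$. For any $\xi\in\mathbb{R}$ there exists a solution $u_\xi\in C^2([0,R_\xi))$ of the Cauchy problem $$\psi u''+\frac{N-1}{r}\Psi u'+g(u)=0,\qquad u(0)=\xi,\qquad u'(0)=0,$$ where $\psi=\lambda$ when $u''\ge0$, $\psi=\Lambda$ when $u''<0$, $\Psi=\lambda$ when $u'\ge0$, $\Psi=\Lambda$ when $u'<0$, and $R_\xi\in(0,+\infty]$ is such that $[0,R_\xi)$ is the maximal interval where $u_\xi$ is defined. Moreover: (i) if $|\xi|=\alpha\in\mathbb{R}$ or $\xi=0$, then $u_\xi\equiv\xi$; (ii) if $\alpha\in\mathbb{R}$ and $|\xi|>\alpha$, then $|u_\xi|$ strictly increases to $+\infty$ on $[0,R_\xi)$; (iii) if $0<\xi<\alpha$, then $R_\xi=+\infty$ and $u_\xi$ is oscillating and localized with $\|u_\xi\|_{L^\infty(\mathbb{R}_+)}=\xi<\alpha$; (iv) if $-\alpha<\xi<0$ and $\Lambda G(\xi)\le\lambda G(\alpha)$, then $R_\xi=+\infty$ and $u_\xi$ is oscillating and localized with $\|u_\xi\|_{L^\infty(\mathbb{R}_+)}<\alpha$.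
   Context: The Cauchy problem is the radial form ($r=|x|$, $u(x)=u(r)$, $x\in\mathbb{R}^N$) of $\mathcal{M}^-_{\lambda,\Lambda}(D^2u)+g(u)=0$, where $\mathcal{M}^-_{\lambda,\Lambda}(D^2u)=\Lambda\sum_{e_i<0}e_i+\lambda\sum_{e_i\ge0}e_i$ and the $e_i$ are the eigenvalues of the Hessian $D^2u$. In the ODE, $\psi$ and $\Psi$ are evaluated pointwise according to the signs of $u''(r)$ and $u'(r)$, and the equation is required for $r>0$. Notation: $G(t)=\int_0^t g(s)\,ds$; if $\alpha=+\infty$, $G(\alpha)$ means $\lim_{t\to+\infty}G(t)\in(0,+\infty]$. $\mathbb{R}_+=[0,+\infty)$. A solution is oscillating if it has an unbounded sequence of zeros. It is localized if (viewed as a radial function on $\mathbb{R}^N$) it converges to zero at infinity together with its partial derivatives up to order $2$. When $\alpha=+\infty$ the condition in (g3) on $(\alpha,+\infty)$ is void. *)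

theory Defs
  imports "HOL-Analysis.Analysis" "HOL-Probability.Essential_Supremum"
begin

text \<open>The interval \<open>[0,R)\<close>, where \<open>R\<close> may be infinite.\<close>

definition ivl :: "ereal \<Rightarrow> real set" where
  "ivl R = {r. 0 \<le> r \<and> ereal r < R}"

text \<open>\<open>u \<in> C\<^sup>2([0,R))\<close> solves the Cauchy problem on \<open>[0,R)\<close>. Derivatives are taken within
  \<open>[0,R)\<close>, hence one-sided at \<open>0\<close>, and the values of \<open>u\<close> outside \<open>[0,R)\<close> are irrelevant.\<close>

definition cauchy_solution ::
  "real \<Rightarrow> real \<Rightarrow> nat \<Rightarrow> (real \<Rightarrow> real) \<Rightarrow> real \<Rightarrow> ereal \<Rightarrow> (real \<Rightarrow> real) \<Rightarrow> bool" where
  "cauchy_solution lam Lam N g \<xi> R u \<longleftrightarrow>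
     0 < R \<and>
     (\<exists>u' u''.
        (\<forall>r\<in>ivl R. (u has_real_derivative u' r) (at r within ivl R)) \<and>
        (\<forall>r\<in>ivl R. (u' has_real_derivative u'' r) (at r within ivl R)) \<and>
        continuous_on (ivl R) u'' \<and>
        u 0 = \<xi> \<and> u' 0 = 0 \<and>
        (\<forall>r\<in>ivl R. 0 < r \<longrightarrow>
           (if u'' r \<ge> 0 then lam else Lam) * u'' r
           + (real N - 1) / r * (if u' r \<ge> 0 then lam else Lam) * u' r
           + g (u r) = 0))"

definition maximal_cauchy_solution ::
  "real \<Rightarrow> real \<Rightarrow> nat \<Rightarrow> (real \<Rightarrow> real) \<Rightarrow> real \<Rightarrow> ereal \<Rightarrow> (real \<Rightarrow> real) \<Rightarrow> bool" where
  "maximal_cauchy_solution lam Lam N g \<xi> R u \<longleftrightarrow>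
     cauchy_solution lam Lam N g \<xi> R u \<and>
     \<not> (\<exists>R' v. R < R' \<and> cauchy_solution lam Lam N g \<xi> R' v \<and> (\<forall>r\<in>ivl R. v r = u r))"

text \<open>The oriented integral from \<open>0\<close> to \<open>t\<close>; \<open>t\<close> may be negative.\<close>

definition primitive :: "(real \<Rightarrow> real) \<Rightarrow> real \<Rightarrow> real" where
  "primitive g t = (LBINT s=0..ereal t. g s)"

text \<open>\<open>G(\<alpha>)\<close> for \<open>\<alpha> \<in> (0,+\<infinity>]\<close>.\<close>

definition primitive_ext :: "(real \<Rightarrow> real) \<Rightarrow> ereal \<Rightarrow> ereal" where
  "primitive_ext g \<alpha> =
     (if \<alpha> = \<infinity> then Lim at_top (\<lambda>t. ereal (primitive g t))
      else ereal (primitive g (real_of_ereal \<alpha>)))"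

definition oscillating :: "(real \<Rightarrow> real) \<Rightarrow> bool" where
  "oscillating u \<longleftrightarrow> (\<exists>z :: nat \<Rightarrow> real. (\<forall>n. 0 \<le> z n \<and> u (z n) = 0) \<and> \<not> bounded (range z))"

definition has_partial :: "'n::finite \<Rightarrow> (real^'n \<Rightarrow> real) \<Rightarrow> (real^'n \<Rightarrow> real) \<Rightarrow> bool" where
  "has_partial i f f' \<longleftrightarrow>
     (\<forall>x. ((\<lambda>t. f (x + t *\<^sub>R axis i 1)) has_real_derivative f' x) (at 0))"

definition localized :: "(real^'n::finite \<Rightarrow> real) \<Rightarrow> bool" where
  "localized U \<longleftrightarrow>
     (U \<longlongrightarrow> 0) at_infinity \<and>
     (\<exists>D H. \<forall>i. has_partial i U (D i) \<and> (D i \<longlongrightarrow> 0) at_infinity \<and>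
        (\<forall>j. has_partial j (D i) (H i j) \<and> (H i j \<longlongrightarrow> 0) at_infinity))"

text \<open>The norm of \<open>u\<close> in \<open>L\<^sup>\<infinity>([0,+\<infinity>))\<close>.\<close>

definition Linf_norm :: "(real \<Rightarrow> real) \<Rightarrow> ereal" where
  "Linf_norm u = esssup (lebesgue_on {0..}) (\<lambda>r. ereal \<bar>u r\<bar>)"

end

theory Submission
  imports Defs
begin

text \<open>
  With \<open>n = N - 1\<close>, \<open>\<theta>(s) = lam s\<close> for \<open>s \<ge> 0\<close>, \<open>\<theta>(s) = Lam s\<close> for \<open>s < 0\<close> and \<open>T = \<theta>\<^sup>-\<^sup>1\<close>, the equation
  is \<open>u'' = T(- (n/r) \<theta>(u') - g(u))\<close>. Since \<open>\<theta>\<close> is positively homogeneous, this is \<open>u'' = A(u'/r, g(u))\<close>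
  with \<open>A(y, h) = T(- n \<theta>(y) - h)\<close>, the function \<open>accel\<close>. What matters is that \<open>A\<close> is
  Lipschitz in \<open>h\<close>, and that in \<open>y\<close> it decreases, at a rate between \<open>n lam / Lam\<close> and \<open>n Lam / lam\<close>.

  \<^bold>\<open>Existence.\<close> The slope \<open>y = u'/r\<close> is regular up to \<open>r = 0\<close>, and integrating
  \<open>(r\<^sup>k u')' = r\<^sup>k (u'' + k y)\<close> shows that it solves
  \<open>y(r) = \<integral>\<^sub>0\<^sup>1 t\<^sup>k (A(y, g(u)) + k y)(r t) dt\<close> for every \<open>k\<close>. For \<open>k \<ge> n Lam / lam\<close> the integrand has Lipschitz
  constant at most \<open>k\<close> in \<open>y\<close>, while \<open>\<integral>\<^sub>0\<^sup>1 t\<^sup>k dt = 1/(k+1)\<close>; the singular term therefore does not spoil the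
  contraction, and the dependence of \<open>u\<close> on \<open>y\<close> is made small by the weight \<open>exp(M r\<^sup>2)\<close>. For a globally
  Lipschitz \<open>g\<close> this gives a solution on \<open>[0,\<infinity>)\<close> at once (\<open>global_radial_solution\<close>). Solutions are unique
  because the damping is monotone in \<open>y\<close>, so the solutions for the truncations of \<open>g\<close> to \<open>[-K, K]\<close> fit
  together to one which is global or unbounded, hence maximal (\<open>maximal_radial_solution\<close>).

  \<^bold>\<open>Energy.\<close> Let \<open>\<rho>(t) = - T(- g(t))\<close> and \<open>\<Gamma>(t) = \<integral>\<^sub>0\<^sup>t \<rho>\<close>. Then \<open>E = u'\<^sup>2/2 + \<Gamma>(u)\<close> satisfies
  \<open>E' = u' (A(u'/r, g(u)) - A(0, g(u))) \<le> - (n lam / Lam) u'\<^sup>2 / r\<close>. Between \<open>-\<alpha>\<close> and \<open>\<alpha>\<close> the potential \<open>\<Gamma>\<close>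
  equals \<open>G / Lam\<close> on the positive and \<open>G / lam\<close> on the negative side, so it is a well whose right wall
  is the lower one. A solution starting at \<open>\<xi> \<in> (0,\<alpha>)\<close> can never exceed \<open>\<xi>\<close> in absolute value; one that starts
  at \<open>\<xi> \<in> (-\<alpha>,0)\<close> is kept below \<open>\<alpha>\<close> if \<open>\<Gamma>(\<xi>) \<le> \<Gamma>(\<alpha>)\<close>, that is, if \<open>Lam G(\<xi>) \<le> lam G(\<alpha>)\<close>, and in case
  of equality because the energy drops strictly at the start. Beyond \<open>\<plusminus>\<alpha>\<close> the potential decreases outwards,
  so a solution that starts there cannot come back; its outward derivative is then positive and the force
  drives it to infinity.

  \<^bold>\<open>Trapped solutions.\<close> Since \<open>g'(0) > 0\<close>, a trapped solution satisfies
  \<open>u u'' \<le> - c u\<^sup>2 + (k/r) |u u'|\<close> with \<open>c > 0\<close>. Without zeros, \<open>q = - u'/u\<close> would satisfy the Riccati inequality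
  \<open>q' \<ge> m (1 + q\<^sup>2)\<close> for large \<open>r\<close>, and \<open>arctan q\<close> would be unbounded (\<open>linear_damping_forces_zero\<close>). The damping
  rate \<open>1/r\<close> is not integrable, and the perturbed energy \<open>E + \<epsilon> u u'/r\<close> decays at a rate proportional to
  \<open>(u\<^sup>2 + u'\<^sup>2)/r\<close>; hence \<open>E\<close> tends to \<open>0\<close> (\<open>energy_vanishes\<close>), and \<open>u\<close>, \<open>u'\<close>, \<open>u''\<close> with it.
\<close>

section \<open>The Pucci nonlinearity and the radial equation\<close>

definition pucci :: "real \<Rightarrow> real \<Rightarrow> real \<Rightarrow> real" where
  "pucci lam Lam s = (if s \<ge> 0 then lam else Lam) * s"

definition pucci_inv :: "real \<Rightarrow> real \<Rightarrow> real \<Rightarrow> real" where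
  "pucci_inv lam Lam s = s / (if s \<ge> 0 then lam else Lam)"

text \<open>The value of \<open>u''\<close> that the equation prescribes, in terms of \<open>y = u'/r\<close> and \<open>h = g(u)\<close>.\<close>

definition accel :: "real \<Rightarrow> real \<Rightarrow> real \<Rightarrow> real \<Rightarrow> real \<Rightarrow> real" where
  "accel lam Lam n y h = pucci_inv lam Lam (- n * pucci lam Lam y - h)"

lemma pucci_scale: "0 < c \<Longrightarrow> pucci lam Lam (s / c) = pucci lam Lam s / c"
  by (auto simp: pucci_def field_simps)

lemma pucci_eq_iff:
  assumes "0 < lam" "0 < Lam"
  shows "pucci lam Lam s = t \<longleftrightarrow> s = pucci_inv lam Lam t"
proof -
  have "pucci_inv lam Lam (pucci lam Lam s) = s"
    using assms mult_pos_neg[of Lam s] by (cases "0 \<le> s") (auto simp: pucci_def pucci_inv_def)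
  moreover have "pucci lam Lam (pucci_inv lam Lam t) = t"
    using assms divide_neg_pos[of t Lam] by (cases "0 \<le> t") (auto simp: pucci_def pucci_inv_def)
  ultimately show ?thesis by auto
qed

lemma pucci_max_min: "pucci lam Lam s = lam * max s 0 + Lam * min s 0"
  by (auto simp: pucci_def)

lemma pucci_inv_max_min: "pucci_inv lam Lam s = max s 0 / lam + min s 0 / Lam"
  by (auto simp: pucci_inv_def)

lemma pucci_diff:
  assumes "lam \<le> Lam" "s \<le> t"
  shows "lam * (t - s) \<le> pucci lam Lam t - pucci lam Lam s"
    and "pucci lam Lam t - pucci lam Lam s \<le> Lam * (t - s)"
proof -
  define a b where "a = max t 0 - max s 0" and "b = min t 0 - min s 0"
  have ab: "0 \<le> a" "0 \<le> b" "t - s = a + b" using assms(2) by (auto simp: a_def b_def)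
  have eq: "pucci lam Lam t - pucci lam Lam s = lam * a + Lam * b"
    by (simp add: pucci_max_min a_def b_def algebra_simps)
  have "lam * a \<le> Lam * a" "lam * b \<le> Lam * b" using assms(1) ab by (auto intro: mult_right_mono)
  then show "lam * (t - s) \<le> pucci lam Lam t - pucci lam Lam s"
    "pucci lam Lam t - pucci lam Lam s \<le> Lam * (t - s)"
    unfolding eq ab(3) by (simp_all add: algebra_simps)
qed

lemma pucci_inv_diff:
  assumes "0 < lam" "lam \<le> Lam" "s \<le> t"
  shows "(t - s) / Lam \<le> pucci_inv lam Lam t - pucci_inv lam Lam s"
    and "pucci_inv lam Lam t - pucci_inv lam Lam s \<le> (t - s) / lam"
proof -
  define a b where "a = max t 0 - max s 0" and "b = min t 0 - min s 0"
  have ab: "0 \<le> a" "0 \<le> b" "t - s = a + b" using assms(3) by (auto simp: a_def b_def)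
  have eq: "pucci_inv lam Lam t - pucci_inv lam Lam s = a / lam + b / Lam"
    by (simp add: pucci_inv_max_min a_def b_def diff_divide_distrib)
  have "a / Lam \<le> a / lam" "b / Lam \<le> b / lam" using assms ab by (auto intro!: divide_left_mono)
  then show "(t - s) / Lam \<le> pucci_inv lam Lam t - pucci_inv lam Lam s"
    "pucci_inv lam Lam t - pucci_inv lam Lam s \<le> (t - s) / lam"
    unfolding eq ab(3) by (simp_all add: add_divide_distrib)
qed

text \<open>The damping coefficient: \<open>\<theta>\<close> has slopes in \<open>[lam, Lam]\<close> and \<open>T\<close> has slopes in \<open>[1/Lam, 1/lam]\<close>, so
  \<open>accel\<close> decreases in \<open>y\<close> at a rate in \<open>[n lam / Lam, n Lam / lam]\<close>.\<close>

lemma accel_antimono_bounds: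
  assumes "0 < lam" "lam \<le> Lam" "0 \<le> n" "y \<le> z"
  shows "n * lam / Lam * (z - y) \<le> accel lam Lam n y h - accel lam Lam n z h"
    and "accel lam Lam n y h - accel lam Lam n z h \<le> n * Lam / lam * (z - y)"
proof -
  let ?d = "n * (pucci lam Lam z - pucci lam Lam y)"
  have d: "n * (lam * (z - y)) \<le> ?d" "?d \<le> n * (Lam * (z - y))"
    using pucci_diff[OF assms(2,4)] assms(3) by (auto intro: mult_left_mono)
  have "0 \<le> n * (lam * (z - y))" using assms by simp
  then have le: "- n * pucci lam Lam z - h \<le> - n * pucci lam Lam y - h"
    using d(1) by (simp add: algebra_simps)
  have eq: "(- n * pucci lam Lam y - h) - (- n * pucci lam Lam z - h) = ?d"
    by (simp add: algebra_simps)
  note * = pucci_inv_diff[OF assms(1,2) le, unfolded eq, folded accel_def]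
  have "n * lam / Lam * (z - y) = n * (lam * (z - y)) / Lam" by simp
  also have "\<dots> \<le> ?d / Lam" using d assms by (intro divide_right_mono) auto
  finally show "n * lam / Lam * (z - y) \<le> accel lam Lam n y h - accel lam Lam n z h"
    using *(1) by linarith
  have "?d / lam \<le> n * (Lam * (z - y)) / lam" using d assms by (intro divide_right_mono) auto
  then show "accel lam Lam n y h - accel lam Lam n z h \<le> n * Lam / lam * (z - y)"
    using *(2) by simp
qed

lemma pucci_inv_lipschitz:
  assumes "0 < lam" "lam \<le> Lam"
  shows "\<bar>pucci_inv lam Lam s - pucci_inv lam Lam t\<bar> \<le> \<bar>s - t\<bar> / lam"
proof (cases "s \<le> t")
  case True
  have "0 \<le> (t - s) / Lam" using True assms by simp
  then show ?thesis using pucci_inv_diff[OF assms True] True by (simp add: abs_if)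
next
  case False
  then have *: "t \<le> s" by simp
  have "0 \<le> (s - t) / Lam" using * assms by simp
  then show ?thesis using pucci_inv_diff[OF assms *] * by (simp add: abs_if)
qed

lemma accel_lipschitz_force:
  assumes "0 < lam" "lam \<le> Lam"
  shows "\<bar>accel lam Lam n y h - accel lam Lam n y k\<bar> \<le> \<bar>h - k\<bar> / lam"
  using pucci_inv_lipschitz[OF assms, of "- n * pucci lam Lam y - h" "- n * pucci lam Lam y - k"]
  by (simp add: accel_def abs_minus_commute)

lemma accel_lipschitz_slope:
  assumes "0 < lam" "lam \<le> Lam" "0 \<le> n"
  shows "\<bar>accel lam Lam n y h - accel lam Lam n z h\<bar> \<le> n * Lam / lam * \<bar>y - z\<bar>"
proof (cases "y \<le> z")
  case True
  have "0 \<le> n * lam / Lam * (z - y)" using True assms by simp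
  then show ?thesis using accel_antimono_bounds[OF assms True, of h] True by (simp add: abs_if)
next
  case False
  then have *: "z \<le> y" by simp
  have "0 \<le> n * lam / Lam * (y - z)" using * assms by simp
  then show ?thesis using accel_antimono_bounds[OF assms *, of h] * by (simp add: abs_if)
qed

lemma accel_zero_slope: "accel lam Lam n 0 h = pucci_inv lam Lam (- h)"
  by (simp add: accel_def pucci_def)

lemma accel_dissipative:
  assumes "0 < lam" "lam \<le> Lam" "0 \<le> n"
  shows "(accel lam Lam n y h - accel lam Lam n z h) * (y - z) \<le> - (n * lam / Lam) * (y - z)\<^sup>2"
proof -
  define A c where "A = accel lam Lam n y h - accel lam Lam n z h" and "c = n * lam / Lam"
  have "A * (y - z) \<le> - c * (y - z)\<^sup>2"
  proof (cases "y \<le> z")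
    case True
    from mult_right_mono[OF accel_antimono_bounds(1)[OF assms True, of h, folded A_def c_def], of "z - y"] True
    show ?thesis by (simp add: power2_eq_square algebra_simps)
  next
    case False
    then have *: "z \<le> y" by simp
    have "c * (y - z) \<le> - A"
      using accel_antimono_bounds(1)[OF assms *, of h] by (simp add: A_def c_def)
    from mult_right_mono[OF this, of "y - z"] *
    show ?thesis by (simp add: power2_eq_square algebra_simps)
  qed
  then show ?thesis by (simp add: A_def c_def)
qed

lemma continuous_on_pucci [continuous_intros]:
  "continuous_on S f \<Longrightarrow> continuous_on S (\<lambda>x. pucci lam Lam (f x))"
  unfolding pucci_max_min by (intro continuous_intros)

lemma continuous_on_pucci_inv [continuous_intros]:
  "continuous_on S f \<Longrightarrow> continuous_on S (\<lambda>x. pucci_inv lam Lam (f x))"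
  unfolding pucci_inv_max_min divide_inverse by (intro continuous_intros)

lemma continuous_on_accel [continuous_intros]:
  assumes "continuous_on S f" "continuous_on S h"
  shows "continuous_on S (\<lambda>x. accel lam Lam n (f x) (h x))"
  unfolding accel_def by (intro continuous_intros assms)

text \<open>The equation solved for \<open>u''\<close>, with the first two derivatives \<open>v\<close> and \<open>w\<close> of \<open>u\<close> as explicit data and on an
  arbitrary set, so that solutions can be restricted and glued.\<close>

definition radial_ode ::
  "real \<Rightarrow> real \<Rightarrow> real \<Rightarrow> (real \<Rightarrow> real) \<Rightarrow> real set \<Rightarrow>
   (real \<Rightarrow> real) \<Rightarrow> (real \<Rightarrow> real) \<Rightarrow> (real \<Rightarrow> real) \<Rightarrow> bool" where
  "radial_ode lam Lam n g I u v w \<longleftrightarrow>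
     (\<forall>r\<in>I. (u has_real_derivative v r) (at r within I)) \<and>
     (\<forall>r\<in>I. (v has_real_derivative w r) (at r within I)) \<and>
     continuous_on I w \<and> v 0 = 0 \<and>
     (\<forall>r\<in>I. 0 < r \<longrightarrow> w r = accel lam Lam n (v r / r) (g (u r)))"

lemma cauchy_solution_iff_radial_ode:
  assumes "0 < lam" "lam \<le> Lam"
  shows "cauchy_solution lam Lam N g \<xi> R u \<longleftrightarrow>
    0 < R \<and> u 0 = \<xi> \<and> (\<exists>v w. radial_ode lam Lam (real N - 1) g (ivl R) u v w)"
proof -
  have "((if w \<ge> 0 then lam else Lam) * w + (real N - 1) / r * (if v \<ge> 0 then lam else Lam) * v + h = 0)
     \<longleftrightarrow> w = accel lam Lam (real N - 1) (v / r) h" (is "?L \<longleftrightarrow> ?R") if "0 < r" for r w v h :: real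
  proof -
    have "?L \<longleftrightarrow> pucci lam Lam w = - (real N - 1) * pucci lam Lam (v / r) - h"
      unfolding pucci_scale[OF that] by (simp add: pucci_def algebra_simps) argo
    also have "\<dots> \<longleftrightarrow> ?R" unfolding accel_def using assms by (intro pucci_eq_iff) auto
    finally show ?thesis .
  qed
  then have ode: "(\<forall>r\<in>ivl R. 0 < r \<longrightarrow>
      (if w r \<ge> 0 then lam else Lam) * w r
      + (real N - 1) / r * (if v r \<ge> 0 then lam else Lam) * v r + g (u r) = 0) \<longleftrightarrow>
    (\<forall>r\<in>ivl R. 0 < r \<longrightarrow> w r = accel lam Lam (real N - 1) (v r / r) (g (u r)))" for v w
    by auto
  show ?thesis
    unfolding cauchy_solution_def radial_ode_def ode
    by (rule iffI; elim conjE exE; intro conjI exI; assumption)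
qed

section \<open>A fixed point equation for the slope\<close>

text \<open>Banach's theorem in the space of continuous functions with \<open>|y| \<le> C W\<close>; dividing by \<open>W\<close> identifies it with
  the bounded continuous functions.\<close>

lemma weighted_contraction_fixed_point:
  fixes \<Phi> :: "(real \<Rightarrow> real) \<Rightarrow> real \<Rightarrow> real" and W :: "real \<Rightarrow> real"
  assumes W: "continuous_on UNIV W" "\<And>r. 0 < W r"
    and cont: "\<And>y. continuous_on UNIV y \<Longrightarrow> continuous_on UNIV (\<Phi> y)"
    and contr: "\<And>y z C r. continuous_on UNIV y \<Longrightarrow> continuous_on UNIV z \<Longrightarrow> 
        (\<And>s. \<bar>y s - z s\<bar> \<le> C * W s) \<Longrightarrow> \<bar>\<Phi> y r - \<Phi> z r\<bar> \<le> c * C * W r"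
    and zero: "\<And>r. \<bar>\<Phi> (\<lambda>_. 0) r\<bar> \<le> B * W r"
    and c: "0 \<le> c" "c < 1"
  obtains y where "continuous_on UNIV y" "\<And>r. y r = \<Phi> y r"
proof -
  define unw :: "(real \<Rightarrow>\<^sub>C real) \<Rightarrow> real \<Rightarrow> real" where "unw z = (\<lambda>r. W r * z r)" for z
  define \<Psi> :: "(real \<Rightarrow>\<^sub>C real) \<Rightarrow> (real \<Rightarrow>\<^sub>C real)"
    where "\<Psi> z = Bcontfun (\<lambda>r. \<Phi> (unw z) r / W r)" for z
  have unw_cont: "continuous_on UNIV (unw z)" for z
    unfolding unw_def by (intro continuous_intros W) auto
  have unw_diff: "\<bar>unw z s - unw z' s\<bar> \<le> dist z z' * W s" for z z' s
  proof -
    have "\<bar>unw z s - unw z' s\<bar> = W s * dist (z s) (z' s)"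
      unfolding unw_def dist_real_def using W(2)[of s]
      by (simp add: abs_mult right_diff_distrib[symmetric])
    also have "\<dots> \<le> W s * dist z z'"
      using W(2)[of s] by (intro mult_left_mono dist_bounded) auto
    finally show ?thesis by (simp add: mult.commute)
  qed
  have in_bcf: "(\<lambda>r. \<Phi> (unw z) r / W r) \<in> bcontfun" for z
  proof -
    have "continuous_on UNIV (\<lambda>r. \<Phi> (unw z) r / W r)"
      using W(2) by (intro continuous_intros cont unw_cont W(1)) (metis less_irrefl)
    moreover have "\<bar>\<Phi> (unw z) r / W r\<bar> \<le> c * dist z 0 + B" for r
    proof -
      have eq: "unw 0 = (\<lambda>_. 0)" by (auto simp: unw_def)
      have "\<bar>\<Phi> (unw z) r - \<Phi> (\<lambda>_. 0) r\<bar> \<le> c * dist z 0 * W r"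
        using contr[OF unw_cont[of z] unw_cont[of 0] unw_diff] by (simp add: eq)
      then have "\<bar>\<Phi> (unw z) r\<bar> \<le> (c * dist z 0 + B) * W r"
        using zero[of r] by (simp add: algebra_simps)
      then show ?thesis using W(2)[of r] by (simp add: divide_le_eq abs_divide)
    qed
    ultimately show ?thesis by (auto simp: bcontfun_def bounded_iff intro!: exI)
  qed
  have \<Psi>: "\<Psi> z r = \<Phi> (unw z) r / W r" for z r
    unfolding \<Psi>_def using Bcontfun_inverse[OF in_bcf] by simp
  have "dist (\<Psi> z) (\<Psi> z') \<le> c * dist z z'" for z z'
  proof (rule dist_bound)
    fix r
    have "dist (\<Psi> z r) (\<Psi> z' r) = \<bar>\<Phi> (unw z) r - \<Phi> (unw z') r\<bar> / W r"
      using W(2)[of r] by (simp add: \<Psi> dist_real_def diff_divide_distrib[symmetric] abs_divide)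
    also have "\<dots> \<le> c * dist z z'"
      using contr[OF unw_cont unw_cont unw_diff] W(2)[of r] by (simp add: pos_divide_le_eq)
    finally show "dist (\<Psi> z r) (\<Psi> z' r) \<le> c * dist z z'" .
  qed
  then obtain z where z: "\<Psi> z = z" using banach_fix_type[OF c, of \<Psi>] by metis
  have "unw z r = \<Phi> (unw z) r" for r
    using arg_cong[OF z, of "\<lambda>z. z r"] W(2)[of r] by (simp add: \<Psi> unw_def field_simps)
  with unw_cont that show thesis by blast
qed

text \<open>Up to the factor \<open>r\<^sup>k\<^sup>+\<^sup>1\<close> this is \<open>\<integral>\<^sub>0\<^sup>r s\<^sup>k f(s) ds\<close>, see \<open>moment_rescaled\<close>; in this form it is continuous at
  \<open>r = 0\<close> and there is nothing to divide by.\<close>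

definition moment :: "nat \<Rightarrow> (real \<Rightarrow> real) \<Rightarrow> real \<Rightarrow> real" where
  "moment k f r = integral {0..1} (\<lambda>t. t ^ k * f (r * t))"

lemma moment_integrand_continuous:
  assumes "continuous_on UNIV f"
  shows "continuous_on A (\<lambda>t::real. t ^ k * f (r * t))"
  by (intro continuous_intros continuous_on_compose2[OF assms]) auto

lemma moment_integrable:
  assumes "continuous_on UNIV f"
  shows "(\<lambda>t::real. t ^ k * f (r * t)) integrable_on {0..1}"
  by (intro integrable_continuous_real moment_integrand_continuous assms)

lemma continuous_moment:
  assumes "continuous_on UNIV f"
  shows "continuous_on UNIV (moment k f)"
proof -
  have "continuous_on UNIV (\<lambda>r. integral (cbox 0 1) (\<lambda>t. t ^ k * f (r * t)))"
    by (rule integral_continuous_on_param)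
      (auto simp: case_prod_unfold intro!: continuous_intros continuous_on_compose2[OF assms])
  then show ?thesis by (simp add: moment_def[abs_def] cbox_interval)
qed

lemma moment_diff:
  assumes "continuous_on UNIV f" "continuous_on UNIV h"
  shows "moment k f r - moment k h r = moment k (\<lambda>s. f s - h s) r"
  unfolding moment_def
  using integral_diff[OF moment_integrable[OF assms(1)] moment_integrable[OF assms(2)], of k r k r]
  by (simp add: right_diff_distrib)

lemma integral_power_unit: "((\<lambda>t::real. t ^ k) has_integral 1 / real (Suc k)) {0..1}"
proof -
  have "((\<lambda>t. t ^ Suc k / real (Suc k)) has_real_derivative t ^ k) (at t within {0..1})" for t :: real
    using DERIV_cdivide[OF DERIV_power_Suc[OF DERIV_ident, of k t "{0..1}"], of "real (Suc k)"]
    by (simp add: add_pos_nonneg del: power_Suc)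
  from fundamental_theorem_of_calculus[OF _ this[unfolded has_real_derivative_iff_has_vector_derivative]]
  show ?thesis by simp
qed

lemma moment_weighted_bound:
  assumes f: "continuous_on UNIV f" and bd: "\<And>s. \<bar>f s\<bar> \<le> C * exp (M * s\<^sup>2)" and "0 \<le> M" 
  shows "\<bar>moment k f r\<bar> \<le> C / real (Suc k) * exp (M * r\<^sup>2)"
proof -
  have C: "0 \<le> C" using bd[of 0] by simp
  have "norm (moment k f r) \<le> integral {0..1} (\<lambda>t. (C * exp (M * r\<^sup>2)) * t ^ k)"
    unfolding moment_def
  proof (rule integral_norm_bound_integral)
    show "(\<lambda>t::real. t ^ k * f (r * t)) integrable_on {0..1}" by (rule moment_integrable[OF f])
    show "(\<lambda>t. (C * exp (M * r\<^sup>2)) * t ^ k) integrable_on {0..1}"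
      by (intro integrable_continuous_real continuous_intros)
    fix t :: real assume t: "t \<in> {0..1}"
    have "t\<^sup>2 \<le> 1" using t by (simp add: power_le_one)
    then have "(r * t)\<^sup>2 \<le> r\<^sup>2" by (simp add: power_mult_distrib mult_left_le)
    then have "exp (M * (r * t)\<^sup>2) \<le> exp (M * r\<^sup>2)" using \<open>0 \<le> M\<close> by (simp add: mult_left_mono)
    then have "\<bar>f (r * t)\<bar> \<le> C * exp (M * r\<^sup>2)"
      using bd[of "r * t"] C mult_left_mono[of "exp (M * (r * t)\<^sup>2)" "exp (M * r\<^sup>2)" C] by linarith
    then show "norm (t ^ k * f (r * t)) \<le> C * exp (M * r\<^sup>2) * t ^ k"
      using t mult_right_mono[of "\<bar>f (r * t)\<bar>" _ "t ^ k"] by (simp add: abs_mult mult.commute mult_left_mono)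
  qed
  also have "\<dots> = C / real (Suc k) * exp (M * r\<^sup>2)"
    using integral_unique[OF has_integral_mult_right[OF integral_power_unit, of "C * exp (M * r\<^sup>2)"]] by simp
  finally show ?thesis by simp
qed

text \<open>The gain \<open>1 / (2 M)\<close> comes from \<open>\<integral>\<^sub>0\<^sup>r s exp(M s\<^sup>2) ds \<le> exp(M r\<^sup>2) / (2 M)\<close>. It is the reason for a Gaussian
  weight: an exponential one would leave a factor \<open>r\<close>, and the contraction would only be local.\<close>

lemma first_moment_weighted_bound:
  assumes f: "continuous_on UNIV f" and bd: "\<And>s. \<bar>f s\<bar> \<le> C * exp (M * s\<^sup>2)" and "0 < M" 
  shows "\<bar>r\<^sup>2 * moment 1 f r\<bar> \<le> C / (2 * M) * exp (M * r\<^sup>2)"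
proof -
  have C: "0 \<le> C" using bd[of 0] by simp
  have "((\<lambda>t. exp (M * (r * t)\<^sup>2) / (2 * M)) has_real_derivative r\<^sup>2 * t * exp (M * (r * t)\<^sup>2))
      (at t within {0..1})" for t
    using \<open>0 < M\<close> by (auto intro!: derivative_eq_intros simp: power2_eq_square field_simps)
  from fundamental_theorem_of_calculus[OF _ this[unfolded has_real_derivative_iff_has_vector_derivative]]
  have I: "((\<lambda>t. r\<^sup>2 * t * exp (M * (r * t)\<^sup>2)) has_integral exp (M * r\<^sup>2) / (2 * M) - 1 / (2 * M)) {0..1}"
    by simp
  have "norm (integral {0..1} (\<lambda>t. r\<^sup>2 * (t ^ 1 * f (r * t))))
      \<le> integral {0..1} (\<lambda>t. C * (r\<^sup>2 * t * exp (M * (r * t)\<^sup>2)))"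
  proof (rule integral_norm_bound_integral)
    show "(\<lambda>t::real. r\<^sup>2 * (t ^ 1 * f (r * t))) integrable_on {0..1}"
      using integrable_cmul[OF moment_integrable[OF f, of 1 r], of "r\<^sup>2"] by simp
    show "(\<lambda>t. C * (r\<^sup>2 * t * exp (M * (r * t)\<^sup>2))) integrable_on {0..1}"
      by (intro integrable_continuous_real continuous_intros)
    fix t :: real assume t: "t \<in> {0..1}"
    have "r\<^sup>2 * t * \<bar>f (r * t)\<bar> \<le> r\<^sup>2 * t * (C * exp (M * (r * t)\<^sup>2))"
      using t bd by (intro mult_left_mono) auto
    then show "norm (r\<^sup>2 * (t ^ 1 * f (r * t))) \<le> C * (r\<^sup>2 * t * exp (M * (r * t)\<^sup>2))"
      using t by (simp add: abs_mult algebra_simps)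
  qed
  also have "integral {0..1} (\<lambda>t. C * (r\<^sup>2 * t * exp (M * (r * t)\<^sup>2))) = C * (exp (M * r\<^sup>2) / (2 * M) - 1 / (2 * M))"
    by (rule integral_unique[OF has_integral_mult_right[OF I]])
  also have "\<dots> \<le> C / (2 * M) * exp (M * r\<^sup>2)"
    using C \<open>0 < M\<close> by (simp add: algebra_simps)
  finally show ?thesis by (simp add: moment_def)
qed

lemma moment_rescaled:
  assumes f: "continuous_on UNIV f" and "0 \<le> r"
  shows "r ^ Suc k * moment k f r = integral {0..r} (\<lambda>s. s ^ k * f s)"
proof -
  define F where "F x = integral {0..x} (\<lambda>s. s ^ k * f s)" for x
  have cont: "continuous_on A (\<lambda>s. s ^ k * f s)" for A
    by (intro continuous_intros continuous_on_subset[OF f]) auto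
  have dF: "(F has_real_derivative x ^ k * f x) (at x within {0..r})" if "x \<in> {0..r}" for x
    unfolding F_def by (rule integral_has_real_derivative[OF cont that])
  have "((\<lambda>t. F (r * t)) has_real_derivative (r * t) ^ k * f (r * t) * r) (at t within {0..1})"
    if "t \<in> {0..1}" for t
  proof -
    have t: "r * t \<in> {0..r}" using that assms(2) by (auto simp: mult_left_le)
    have "(\<lambda>t. r * t) ` {0..1} \<subseteq> {0..r}" using assms(2) by (auto simp: mult_left_le)
    then have *: "(F has_real_derivative (r * t) ^ k * f (r * t)) (at (r * t) within (\<lambda>t. r * t) ` {0..1})"
      by (rule DERIV_subset[OF dF[OF t]])
    show ?thesis
      using DERIV_image_chain[OF *, of r] by (auto simp: o_def intro!: derivative_eq_intros)
  qed
  from fundamental_theorem_of_calculus[OF _ this[unfolded has_real_derivative_iff_has_vector_derivative]]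
  have "((\<lambda>t. (r * t) ^ k * f (r * t) * r) has_integral F r - F 0) {0..1}" by simp
  moreover have "F 0 = 0" by (simp add: F_def)
  moreover have "(\<lambda>t. (r * t) ^ k * f (r * t) * r) = (\<lambda>t. r ^ Suc k * (t ^ k * f (r * t)))"
    by (auto simp: power_mult_distrib)
  ultimately have "((\<lambda>t. r ^ Suc k * (t ^ k * f (r * t))) has_integral F r) {0..1}" by simp
  from integral_unique[OF this] show ?thesis
    by (simp only: moment_def F_def integral_mult_right)
qed

lemma at_within_Icc_eq_at_within_atLeast:
  fixes r b :: real
  assumes "r < b"
  shows "at r within {0..b} = at r within {0..}"
  by (rule at_within_nhd[of r "{..<b}"]) (use assms in auto)

lemma has_real_derivative_integral_atLeast:
  assumes f: "continuous_on UNIV f" and "0 \<le> r"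
  shows "((\<lambda>x. integral {0..x} f) has_real_derivative f r) (at r within {0..})"
  using integral_has_real_derivative[OF continuous_on_subset[OF f subset_UNIV], of r 0 "r + 1"] assms(2)
  by (simp add: at_within_Icc_eq_at_within_atLeast)

text \<open>Adding \<open>K y\<close> turns the decreasing function into a nondecreasing one of slope at most \<open>K\<close>. The slope of
  the damping term itself can be as large as \<open>n Lam / lam\<close>, which is too much for a contraction.\<close>

lemma accel_plus_slope_lipschitz:
  assumes "0 < lam" "lam \<le> Lam" "0 \<le> n" "n * Lam / lam \<le> K"
  shows "\<bar>(accel lam Lam n y h + K * y) - (accel lam Lam n z h + K * z)\<bar> \<le> K * \<bar>y - z\<bar>"
proof -
  have *: "\<bar>(accel lam Lam n y h + K * y) - (accel lam Lam n z h + K * z)\<bar> \<le> K * (z - y)" if "y \<le> z" for y z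
  proof -
    have "0 \<le> n * lam / Lam * (z - y)" using that assms by simp
    moreover have "n * Lam / lam * (z - y) \<le> K * (z - y)"
      using that assms by (intro mult_right_mono) auto
    ultimately show ?thesis
      using accel_antimono_bounds[OF assms(1-3) that, of h] by (simp add: abs_le_iff algebra_simps)
  qed
  show ?thesis
    using *[of y z] *[of z y] by (cases "y \<le> z") (auto simp: abs_minus_commute)
qed

text \<open>The contraction constant is \<open>(k + L/(L+1)) / (k+1)\<close>: \<open>k\<close> from the damping, \<open>L/(L+1)\<close> from the dependence of
  \<open>g(u)\<close> on \<open>y\<close>, and \<open>1/(k+1)\<close> from the moment.\<close>

lemma slope_fixed_point:
  assumes lam: "0 < lam" "lam \<le> Lam" and n: "0 \<le> n" and g: "L-lipschitz_on UNIV g"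
    and K: "n * Lam / lam \<le> real k"
  obtains y where "continuous_on UNIV y"
    "\<And>r. y r = moment k (\<lambda>s. accel lam Lam n (y s) (g (\<xi> + s\<^sup>2 * moment 1 y s)) + real k * y s) r"
proof -
  define M where "M = (L + 1) / (2 * lam)"
  have L: "0 \<le> L" using g by (rule lipschitz_on_nonneg)
  have M: "0 < M" using L lam by (simp add: M_def)
  have g_cont: "continuous_on UNIV g" using g by (rule lipschitz_on_continuous_on)
  define U where "U y s = \<xi> + s\<^sup>2 * moment 1 y s" for y s
  define H where "H y s = accel lam Lam n (y s) (g (U y s)) + real k * y s" for y s
  have U_cont: "continuous_on UNIV (U y)" if "continuous_on UNIV y" for y
    unfolding U_def by (intro continuous_intros continuous_moment that)
  have H_cont: "continuous_on UNIV (H y)" if y: "continuous_on UNIV y" for y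
    unfolding H_def using y
    by (intro continuous_intros continuous_on_compose2[OF g_cont U_cont]) auto
  have H_diff: "\<bar>H y s - H z s\<bar> \<le> (real k + L / (L + 1)) * C * exp (M * s\<^sup>2)"
    if y: "continuous_on UNIV y" and z: "continuous_on UNIV z"
      and yz: "\<And>s. \<bar>y s - z s\<bar> \<le> C * exp (M * s\<^sup>2)" for y z C s
  proof -
    let ?A = "accel lam Lam n"
    have "\<bar>U y s - U z s\<bar> = \<bar>s\<^sup>2 * moment 1 (\<lambda>s. y s - z s) s\<bar>"
      unfolding U_def moment_diff[OF y z, symmetric] by (simp add: algebra_simps)
    also have "\<dots> \<le> C / (2 * M) * exp (M * s\<^sup>2)"
      using y z yz M by (intro first_moment_weighted_bound continuous_intros)
    finally have "L * \<bar>U y s - U z s\<bar> / lam \<le> L * (C / (2 * M) * exp (M * s\<^sup>2)) / lam"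
      using L lam by (intro divide_right_mono mult_left_mono) auto
    moreover have "\<bar>g (U y s) - g (U z s)\<bar> / lam \<le> L * \<bar>U y s - U z s\<bar> / lam"
      using lipschitz_onD[OF g] lam(1) by (intro divide_right_mono) (simp_all add: dist_real_def)
    moreover have "\<bar>?A (z s) (g (U y s)) - ?A (z s) (g (U z s))\<bar> \<le> \<bar>g (U y s) - g (U z s)\<bar> / lam"
      by (rule accel_lipschitz_force[OF lam])
    ultimately have "\<bar>?A (z s) (g (U y s)) - ?A (z s) (g (U z s))\<bar> \<le> L * (C / (2 * M) * exp (M * s\<^sup>2)) / lam"
      by linarith
    also have "\<dots> = L / (L + 1) * C * exp (M * s\<^sup>2)"
      using lam L by (simp add: M_def divide_simps)
    finally have 1: "\<bar>?A (z s) (g (U y s)) - ?A (z s) (g (U z s))\<bar> \<le> L / (L + 1) * C * exp (M * s\<^sup>2)" .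
    have "\<bar>(?A (y s) (g (U y s)) + real k * y s) - (?A (z s) (g (U y s)) + real k * z s)\<bar>
        \<le> real k * \<bar>y s - z s\<bar>"
      by (rule accel_plus_slope_lipschitz[OF lam n K])
    also have "\<dots> \<le> real k * (C * exp (M * s\<^sup>2))" using yz by (intro mult_left_mono) auto
    finally show ?thesis using 1 unfolding H_def by (simp add: algebra_simps)
  qed
  define c where "c = (real k + L / (L + 1)) / real (Suc k)"
  have "L / (L + 1) < 1" using L by simp
  then have c: "0 \<le> c" "c < 1" using L by (auto simp: c_def)
  obtain y where "continuous_on UNIV y" "\<And>r. y r = moment k (H y) r"
  proof (rule weighted_contraction_fixed_point[where W = "\<lambda>r. exp (M * r\<^sup>2)" and c = c
        and \<Phi> = "\<lambda>y. moment k (H y)" and B = "\<bar>H (\<lambda>_. 0) 0\<bar> / real (Suc k)"])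
    show "\<bar>moment k (H y) r - moment k (H z) r\<bar> \<le> c * C * exp (M * r\<^sup>2)"
      if y: "continuous_on UNIV y" and z: "continuous_on UNIV z"
        and yz: "\<And>s. \<bar>y s - z s\<bar> \<le> C * exp (M * s\<^sup>2)" for y z C r
    proof -
      have "\<bar>moment k (\<lambda>s. H y s - H z s) r\<bar> 
          \<le> (real k + L / (L + 1)) * C / real (Suc k) * exp (M * r\<^sup>2)"
        using H_cont[OF y] H_cont[OF z] H_diff[OF y z yz] M
        by (intro moment_weighted_bound continuous_intros) auto
      then show ?thesis unfolding moment_diff[OF H_cont[OF y] H_cont[OF z]] c_def by simp
    qed
    have const: "H (\<lambda>_. 0) s = H (\<lambda>_. 0) 0" for s by (simp add: H_def U_def moment_def)
    have "\<bar>H (\<lambda>_. 0) 0\<bar> * 1 \<le> \<bar>H (\<lambda>_. 0) 0\<bar> * exp (M * s\<^sup>2)" for s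
      using M by (intro mult_left_mono) auto
    then have "\<bar>H (\<lambda>_. 0) s\<bar> \<le> \<bar>H (\<lambda>_. 0) 0\<bar> * exp (M * s\<^sup>2)" for s
      unfolding const[of s] by simp
    then show "\<bar>moment k (H (\<lambda>_. 0)) r\<bar> \<le> \<bar>H (\<lambda>_. 0) 0\<bar> / real (Suc k) * exp (M * r\<^sup>2)" for r
      using M by (intro moment_weighted_bound H_cont) auto
    show "continuous_on UNIV (\<lambda>r. exp (M * r\<^sup>2))" by (intro continuous_intros)
  qed (use c in \<open>simp_all add: continuous_moment H_cont\<close>)
  then show thesis using that unfolding H_def U_def by blast
qed

text \<open>The fixed point equation says \<open>r\<^sup>k u' = \<integral>\<^sub>0\<^sup>r s\<^sup>k (A(y, g(u)) + k y) ds\<close> for \<open>u' = r y\<close>. Differentiating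
  gives the equation for \<open>r > 0\<close>. At the origin it reads \<open>(k+1) y(0) = A(y(0), g(\<xi>)) + k y(0)\<close>, so that
  \<open>u''(0) = y(0)\<close> is the limit of \<open>u''\<close>.\<close>

theorem global_radial_solution:
  assumes lam: "0 < lam" "lam \<le> Lam" and n: "0 \<le> n" and g: "L-lipschitz_on UNIV g"
  obtains u v w where "radial_ode lam Lam n g {0..} u v w" "u 0 = \<xi>"
proof -
  \<comment> \<open>an integer exponent suffices, and keeps the moments polynomial\<close>
  obtain k :: nat where K: "n * Lam / lam \<le> real k" using real_arch_simple by blast
  obtain y where y: "continuous_on UNIV y"
    and fp: "\<And>r. y r = moment k (\<lambda>s. accel lam Lam n (y s) (g (\<xi> + s\<^sup>2 * moment 1 y s)) + real k * y s) r"
    using slope_fixed_point[OF lam n g K, of \<xi>] by blast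
  define u v w where "u s = \<xi> + s\<^sup>2 * moment 1 y s" and "v s = s * y s"
    and "w s = accel lam Lam n (y s) (g (u s))" for s
  define H where "H s = w s + real k * y s" for s
  have fp: "y r = moment k H r" for r using fp[of r] by (simp add: H_def[abs_def] w_def u_def)
  have u_cont: "continuous_on UNIV u"
    unfolding u_def by (intro continuous_intros continuous_moment y)
  have w_cont: "continuous_on UNIV w"
    unfolding w_def using y lipschitz_on_continuous_on[OF g]
    by (intro continuous_intros continuous_on_compose2[OF _ u_cont]) auto
  have H_cont: "continuous_on UNIV H" unfolding H_def by (intro continuous_intros w_cont y)
  have du: "(u has_real_derivative v r) (at r within {0..})" if "0 \<le> r" for r
  proof -
    have *: "u x = \<xi> + integral {0..x} (\<lambda>s. s * y s)" if "0 \<le> x" for x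
      using moment_rescaled[OF y that, of 1] by (simp add: u_def power2_eq_square)
    have "((\<lambda>x. \<xi> + integral {0..x} (\<lambda>s. s * y s)) has_real_derivative 0 + v r) (at r within {0..})"
      unfolding v_def using that
      by (intro DERIV_add DERIV_const has_real_derivative_integral_atLeast continuous_intros y)
    then have "((\<lambda>x. \<xi> + integral {0..x} (\<lambda>s. s * y s)) has_real_derivative v r) (at r within {0..})"
      by simp
    then show ?thesis
      by (rule has_field_derivative_transform_within[where d = 1]) (use that * in auto)
  qed
  have dv: "(v has_real_derivative w r) (at r within {0..})" if "0 \<le> r" for r
  proof (cases "r = 0")
    case True
    have "y 0 = H 0 / real (Suc k)"
      using integral_unique[OF has_integral_mult_left[OF integral_power_unit[of k], of "H 0"]]
      by (simp add: fp[of 0] moment_def mult.commute)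
    then have "w 0 = y 0" by (simp add: H_def field_simps)
    have "(y \<longlongrightarrow> y 0) (at 0 within {0..})"
      using continuous_on_subset[OF y subset_UNIV, of "{0..}"] by (auto simp: continuous_on_def)
    then have "((\<lambda>z. (v z - v 0) / (z - 0)) \<longlongrightarrow> y 0) (at 0 within {0..})"
      by (rule Lim_transform_within[where d = 1]) (auto simp: v_def)
    then show ?thesis using True \<open>w 0 = y 0\<close> by (simp add: has_field_derivative_iff)
  next
    case False
    then have r: "0 < r" using that by simp
    define F where "F x = integral {0..x} (\<lambda>s. s ^ k * H s)" for x
    have F: "F x = x ^ Suc k * y x" if "0 \<le> x" for x
      using moment_rescaled[OF H_cont that, of k] by (simp add: F_def fp[of x])
    have "continuous_on UNIV (\<lambda>s. s ^ k * H s)" by (intro continuous_intros H_cont)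
    then have "(F has_real_derivative r ^ k * H r) (at r within {0..})"
      unfolding F_def by (rule has_real_derivative_integral_atLeast) fact
    moreover have at: "at r within {0..} = at r" by (rule at_within_interior) (use r in simp)
    ultimately have F': "(F has_real_derivative r ^ k * H r) (at r)" by simp
    have "((\<lambda>x. F x / x ^ k) has_real_derivative
        (r ^ k * H r * r ^ k - F r * (real k * r ^ (k - Suc 0))) / (r ^ k * r ^ k)) (at r)"
      using r by (intro DERIV_divide F' DERIV_pow) auto
    moreover have "(r ^ k * H r * r ^ k - F r * (real k * r ^ (k - Suc 0))) / (r ^ k * r ^ k) = w r"
      using r unfolding F[OF that] H_def by (cases k) (auto simp: field_simps)
    ultimately have dF: "((\<lambda>x. F x / x ^ k) has_real_derivative w r) (at r)" by simp
    have "eventually (\<lambda>x. x \<in> {0<..}) (nhds r)"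
      using r by (intro eventually_nhds_in_open) auto
    then have "eventually (\<lambda>x. v x = F x / x ^ k) (nhds r)"
      by eventually_elim (auto simp: F v_def)
    then have "(v has_real_derivative w r) (at r) \<longleftrightarrow> ((\<lambda>x. F x / x ^ k) has_real_derivative w r) (at r)"
      by (intro DERIV_cong_ev refl)
    with dF show ?thesis unfolding at by blast
  qed
  have "radial_ode lam Lam n g {0..} u v w"
    unfolding radial_ode_def using du dv continuous_on_subset[OF w_cont, of "{0..}"]
    by (simp add: v_def w_def)
  then show thesis by (rule that) (simp add: u_def)
qed

section \<open>Uniqueness and maximal solutions\<close>

lemma radial_ode_continuous:
  assumes "radial_ode lam Lam n g I u v w"
  shows "continuous_on I u" "continuous_on I v" "continuous_on I w"
  using assms unfolding radial_ode_def by (auto intro!: DERIV_continuous_on)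

lemma radial_ode_equation:
  assumes "radial_ode lam Lam n g I u v w" "r \<in> I" "0 < r"
  shows "w r = accel lam Lam n (v r / r) (g (u r))"
  using assms by (simp add: radial_ode_def)

lemma radial_ode_deriv_interior:
  assumes "radial_ode lam Lam n g I u v w" "r \<in> interior I"
  shows "(u has_real_derivative v r) (at r)" "(v has_real_derivative w r) (at r)"
  using assms at_within_interior[OF assms(2)] interior_subset[of I] unfolding radial_ode_def by force+

lemma radial_ode_subset:
  assumes "radial_ode lam Lam n g I u v w" "J \<subseteq> I"
  shows "radial_ode lam Lam n g J u v w"
  using assms unfolding radial_ode_def
  by (auto intro: DERIV_subset continuous_on_subset)

lemma radial_ode_cong_force:
  assumes "radial_ode lam Lam n g I u v w" "\<And>r. r \<in> I \<Longrightarrow> g (u r) = h (u r)"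
  shows "radial_ode lam Lam n h I u v w"
  using assms unfolding radial_ode_def by auto

text \<open>The difference of the damping terms has the sign opposite to \<open>v - v'\<close>, so the singular coefficient \<open>1/r\<close>
  only helps and Gronwall's inequality for \<open>(v - v')\<^sup>2 + (u - u')\<^sup>2\<close> works up to the origin.\<close>

lemma radial_ode_unique:
  assumes lam: "0 < lam" "lam \<le> Lam" and n: "0 \<le> n" and g: "L-lipschitz_on UNIV g"
    and 1: "radial_ode lam Lam n g {0..b} u v w" and 2: "radial_ode lam Lam n g {0..b} u' v' w'"
    and 0: "u 0 = u' 0" and r: "0 \<le> r" "r \<le> b"
  shows "u r = u' r" "v r = v' r"
proof -
  define C where "C = L / lam + 1"
  define D where "D x = exp (- C * x) * ((v x - v' x)\<^sup>2 + (u x - u' x)\<^sup>2)" for x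
  have L: "0 \<le> L" using g by (rule lipschitz_on_nonneg)
  have growth: "2 * (v x - v' x) * (w x - w' x) + 2 * (u x - u' x) * (v x - v' x)
      \<le> C * ((v x - v' x)\<^sup>2 + (u x - u' x)\<^sup>2)" if x: "0 < x" "x < r" for x
  proof -
    define d e q where "d = v x - v' x" and "e = u x - u' x" and "q = L / lam"
    let ?A = "\<lambda>v u. accel lam Lam n (v / x) (g u)"
    have w: "w x = ?A (v x) (u x)" "w' x = ?A (v' x) (u' x)"
      using 1 2 x r unfolding radial_ode_def by auto
    have "(?A (v x) (u x) - ?A (v' x) (u x)) * (d / x) \<le> - (n * lam / Lam) * (d / x)\<^sup>2"
      using accel_dissipative[OF lam n, of "v x / x" "g (u x)" "v' x / x"] by (simp add: d_def diff_divide_distrib)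
    also have "\<dots> \<le> 0" using lam n by simp
    finally have a: "(?A (v x) (u x) - ?A (v' x) (u x)) * d \<le> 0"
      using x by (simp add: divide_le_0_iff)
    have "\<bar>?A (v' x) (u x) - ?A (v' x) (u' x)\<bar> \<le> \<bar>g (u x) - g (u' x)\<bar> / lam"
      by (rule accel_lipschitz_force[OF lam])
    also have "\<dots> \<le> L * \<bar>e\<bar> / lam"
      using lipschitz_onD[OF g, of "u x" "u' x"] lam(1) 
      by (intro divide_right_mono) (simp_all add: dist_real_def e_def)
    finally have "\<bar>?A (v' x) (u x) - ?A (v' x) (u' x)\<bar> * \<bar>d\<bar> \<le> (q * \<bar>e\<bar>) * \<bar>d\<bar>"
      by (intro mult_right_mono) (simp_all add: q_def)
    moreover have "(?A (v' x) (u x) - ?A (v' x) (u' x)) * d \<le> \<bar>?A (v' x) (u x) - ?A (v' x) (u' x)\<bar> * \<bar>d\<bar>"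
      by (metis abs_ge_self abs_mult)
    ultimately have "(w x - w' x) * d \<le> q * (\<bar>e\<bar> * \<bar>d\<bar>)"
      using a by (simp add: w algebra_simps)
    moreover have ed: "2 * (\<bar>e\<bar> * \<bar>d\<bar>) \<le> d\<^sup>2 + e\<^sup>2"
      using sum_squares_bound[of "\<bar>e\<bar>" "\<bar>d\<bar>"] by simp
    moreover have "q * (2 * (\<bar>e\<bar> * \<bar>d\<bar>)) \<le> q * (d\<^sup>2 + e\<^sup>2)"
      using L lam ed by (intro mult_left_mono) (auto simp: q_def)
    moreover have "e * d \<le> \<bar>e\<bar> * \<bar>d\<bar>" by (metis abs_ge_self abs_mult)
    ultimately have "2 * ((w x - w' x) * d) + 2 * (e * d) \<le> q * (d\<^sup>2 + e\<^sup>2) + (d\<^sup>2 + e\<^sup>2)"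
      by (simp add: distrib_left)
    then show ?thesis by (simp add: C_def d_def e_def q_def algebra_simps)
  qed
  have "D r \<le> D 0"
  proof (rule DERIV_nonpos_imp_decreasing_open[OF r(1)])
    fix x assume x: "0 < x" "x < r"
    then have "x \<in> interior {0..b}" using r by simp
    note d = radial_ode_deriv_interior[OF 1 this] radial_ode_deriv_interior[OF 2 this]
    have "(D has_real_derivative exp (- C * x) *
       (2 * (v x - v' x) * (w x - w' x) + 2 * (u x - u' x) * (v x - v' x)
         - C * ((v x - v' x)\<^sup>2 + (u x - u' x)\<^sup>2))) (at x)"
      unfolding D_def by (rule derivative_eq_intros d refl)+ (simp add: algebra_simps)
    moreover have "exp (- C * x) *
       (2 * (v x - v' x) * (w x - w' x) + 2 * (u x - u' x) * (v x - v' x)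
         - C * ((v x - v' x)\<^sup>2 + (u x - u' x)\<^sup>2)) \<le> 0"
      using growth[OF x] by (simp add: mult_le_0_iff)
    ultimately show "\<exists>y. (D has_real_derivative y) (at x) \<and> y \<le> 0" by blast
  next
    note c = radial_ode_continuous[OF 1] radial_ode_continuous[OF 2]
    show "continuous_on {0..r} D"
      unfolding D_def by (intro continuous_intros; rule continuous_on_subset, rule c) (use r in auto)
  qed
  also have "D 0 = 0" using 0 1 2 by (simp add: D_def radial_ode_def)
  finally have "(v r - v' r)\<^sup>2 + (u r - u' r)\<^sup>2 \<le> 0" by (simp add: D_def mult_le_0_iff)
  then show "u r = u' r" "v r = v' r"
    by (simp_all add: sum_power2_le_zero_iff)
qed

lemma radial_ode_second_derivative_unique:
  assumes 1: "radial_ode lam Lam n g {0..b} u v w" and 2: "radial_ode lam Lam n g' {0..b} u' v' w'"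
    and eq: "\<And>r. r \<in> {0..b} \<Longrightarrow> v r = v' r" and r: "r \<in> {0..b}" "0 < b"
  shows "w r = w' r"
proof -
  have "(v has_real_derivative w r) (at r within cbox 0 b)"
    using 1 r by (simp add: radial_ode_def)
  moreover have "(v' has_real_derivative w' r) (at r within cbox 0 b)"
    using 2 r by (simp add: radial_ode_def)
  then have "(v has_real_derivative w' r) (at r within cbox 0 b)"
    by (rule has_field_derivative_transform_within[where d = 1]) (use r eq in auto)
  ultimately show ?thesis
    using vector_derivative_unique_within_closed_interval[of 0 b r v "w r" "w' r"] r
    by (simp add: has_real_derivative_iff_has_vector_derivative)
qed

definition clamp_to :: "real \<Rightarrow> real \<Rightarrow> real" where
  "clamp_to K t = max (- K) (min K t)"

lemma clamp_to_id: "\<bar>t\<bar> \<le> K \<Longrightarrow> clamp_to K t = t"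
  by (auto simp: clamp_to_def)

lemma lipschitz_clamped:
  assumes "L-lipschitz_on {-K..K} g" "0 \<le> K"
  shows "L-lipschitz_on UNIV (\<lambda>t. g (clamp_to K t))"
proof (rule lipschitz_onI)
  fix s t :: real
  have "dist (g (clamp_to K s)) (g (clamp_to K t)) \<le> L * dist (clamp_to K s) (clamp_to K t)"
    using assms by (intro lipschitz_onD) (auto simp: clamp_to_def)
  also have "\<dots> \<le> L * dist s t"
    using lipschitz_on_nonneg[OF assms(1)]
    by (intro mult_left_mono) (auto simp: clamp_to_def dist_real_def)
  finally show "dist (g (clamp_to K s)) (g (clamp_to K t)) \<le> L * dist s t" .
qed (use assms lipschitz_on_nonneg in blast)

lemma local_lipschitz_Icc:
  assumes "local_lipschitz (UNIV :: real set) UNIV (\<lambda>_. g :: real \<Rightarrow> real)"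
  obtains L where "L-lipschitz_on {a..b} g"
proof -
  have "local_lipschitz {0::real} {a..b} (\<lambda>_. g)"
    by (rule local_lipschitz_subset[OF assms]) auto
  from local_lipschitz_compact_implies_lipschitz[OF this]
  obtain L where "\<And>t. t \<in> {0::real} \<Longrightarrow> L-lipschitz_on {a..b} g" by auto
  then show thesis by (auto intro: that)
qed

text \<open>Let \<open>U K\<close> be the global solution for \<open>g\<close> truncated to \<open>[-K, K]\<close>. As long as \<open>|U K| \<le> K\<close> it solves the original
  problem and agrees with \<open>U M\<close> whenever \<open>|U K| \<le> M\<close>. The lengths of the intervals on which some \<open>K\<close> is good
  enough form an interval \<open>[0,R)\<close>, open on the right since \<open>K + 1\<close> is good for longer than \<open>K\<close>. If the glued
  solution were bounded by \<open>M\<close> with \<open>R < \<infinity>\<close>, then \<open>U M\<close> would be good up to and including \<open>R\<close>.\<close>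

theorem maximal_radial_solution:
  assumes lam: "0 < lam" "lam \<le> Lam" and n: "0 \<le> n"
    and g: "local_lipschitz (UNIV :: real set) UNIV (\<lambda>_. g :: real \<Rightarrow> real)"
  obtains R u v w where "0 < R" "radial_ode lam Lam n g (ivl R) u v w" "u 0 = \<xi>"
    "\<And>M. R < \<infinity> \<Longrightarrow> \<exists>r\<in>ivl R. M < \<bar>u r\<bar>"
proof -
  define h where "h K = (\<lambda>t. g (clamp_to (real K) t))" for K :: nat
  have h_lip: "\<exists>L. L-lipschitz_on UNIV (h K)" for K
    using local_lipschitz_Icc[OF g, of "- real K" "real K"] lipschitz_clamped[of _ "real K" g]
    unfolding h_def by (metis of_nat_0_le_iff)
  have "\<exists>u v w. radial_ode lam Lam n (h K) {0..} u v w \<and> u 0 = \<xi>" for K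
    using h_lip[of K] global_radial_solution[OF lam n] by metis
  then obtain U V W where sol: "\<And>K. radial_ode lam Lam n (h K) {0..} (U K) (V K) (W K)"
    and init: "\<And>K. U K 0 = \<xi>" by metis
  define ok where "ok K b \<longleftrightarrow> 0 \<le> b \<and> (\<forall>r\<in>{0..b}. \<bar>U K r\<bar> \<le> real K)" for K b
  have agree1: "U M r = U K r \<and> V M r = V K r"
    if K: "ok K b" and M: "\<And>r. r \<in> {0..b} \<Longrightarrow> \<bar>U K r\<bar> \<le> real M" and r: "r \<in> {0..b}" for K M b r
  proof -
    obtain L where L: "L-lipschitz_on UNIV (h M)" using h_lip by blast
    have "radial_ode lam Lam n (h K) {0..b} (U K) (V K) (W K)"
      by (rule radial_ode_subset[OF sol]) auto
    then have "radial_ode lam Lam n (h M) {0..b} (U K) (V K) (W K)"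
      by (rule radial_ode_cong_force) (use K M in \<open>auto simp: h_def ok_def clamp_to_id\<close>)
    moreover have "radial_ode lam Lam n (h M) {0..b} (U M) (V M) (W M)"
      by (rule radial_ode_subset[OF sol]) auto
    ultimately show ?thesis
      using radial_ode_unique[OF lam n L] r init by (metis atLeastAtMost_iff)
  qed
  have agree: "U K r = U K' r \<and> V K r = V K' r" if "ok K b" "ok K' b" "r \<in> {0..b}" for K K' b r
  proof -
    have le: "\<And>x. x \<le> real K \<Longrightarrow> x \<le> real (max K K')" "\<And>x. x \<le> real K' \<Longrightarrow> x \<le> real (max K K')"
      by auto
    have "U (max K K') r = U K r \<and> V (max K K') r = V K r"
      using that by (intro agree1[of K b] le(1)) (auto simp: ok_def)
    moreover have "U (max K K') r = U K' r \<and> V (max K K') r = V K' r"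
      using that by (intro agree1[of K' b] le(2)) (auto simp: ok_def)
    ultimately show ?thesis by simp
  qed
  have agreeW: "W K r = W K' r" if "ok K b" "ok K' b" "r \<in> {0..b}" "0 < b" for K K' b r
    using radial_ode_second_derivative_unique[of lam Lam n "h K" b "U K" "V K" "W K" "h K'" "U K'" "V K'" "W K'" r]
      radial_ode_subset[OF sol, of "{0..b}"] agree[OF that(1,2)] that by auto
  have ok_mono: "ok K c" if "ok K b" "0 \<le> c" "c \<le> b" for K b c
    using that by (auto simp: ok_def)
  have ok_extend: "\<exists>b'>b. ok (Suc K) b'" if "ok K b" for K b
  proof -
    have "continuous_on {0..} (U (Suc K))" by (rule radial_ode_continuous[OF sol])
    moreover have b: "b \<in> {0..}" using that by (simp add: ok_def)
    ultimately obtain d where d: "d > 0" "\<And>r. r \<in> {0..} \<Longrightarrow> dist r b < d \<Longrightarrow> dist (U (Suc K) r) (U (Suc K) b) < 1"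
      unfolding continuous_on_iff by (metis zero_less_one)
    have eq: "U (Suc K) r = U K r" if "r \<in> {0..b}" for r
    proof -
      have "\<bar>U K x\<bar> \<le> real (Suc K)" if "x \<in> {0..b}" for x
      proof -
        have "\<bar>U K x\<bar> \<le> real K" using \<open>ok K b\<close> that by (simp add: ok_def)
        then show ?thesis by simp
      qed
      then show ?thesis using agree1[OF \<open>ok K b\<close> _ that, of "Suc K"] by blast
    qed
    have "\<bar>U (Suc K) r\<bar> \<le> real (Suc K)" if r: "r \<in> {0..b + d / 2}" for r
    proof (cases "r \<le> b")
      case True
      then show ?thesis using \<open>ok K b\<close> r eq[of r] by (force simp: ok_def)
    next
      case False
      have "\<bar>U (Suc K) b\<bar> \<le> real K" using \<open>ok K b\<close> b eq[of b] by (auto simp: ok_def)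
      moreover have "dist (U (Suc K) r) (U (Suc K) b) < 1"
        using False r b d(1) by (intro d(2)) (auto simp: dist_real_def)
      ultimately show ?thesis by (simp add: dist_real_def)
    qed
    then have "ok (Suc K) (b + d / 2)" using b d(1) by (simp add: ok_def)
    then show ?thesis using d(1) by (intro exI[of _ "b + d / 2"]) auto
  qed
  define S where "S = {b. \<exists>K. ok K b}"
  define R where "R = Sup (ereal ` S)"
  obtain K0 :: nat where K0: "\<bar>\<xi>\<bar> \<le> real K0" using real_arch_simple by blast
  then have "0 \<in> S" by (auto simp: S_def ok_def init)
  have S_nonneg: "0 \<le> b" if "b \<in> S" for b using that by (auto simp: S_def ok_def)
  have S_larger: "\<exists>b'\<in>S. b < b'" if "b \<in> S" for b
    using that ok_extend unfolding S_def by blast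
  have ivl_S: "r \<in> ivl R \<longleftrightarrow> r \<in> S" for r
  proof
    assume r: "r \<in> ivl R"
    then obtain b where "b \<in> S" "r < b" unfolding ivl_def R_def by (auto simp: less_Sup_iff)
    then show "r \<in> S" using r ok_mono[of _ b r] by (auto simp: S_def ivl_def)
  next
    assume "r \<in> S"
    then obtain b where "b \<in> S" "r < b" using S_larger by blast
    then have "ereal r < R" unfolding R_def less_Sup_iff by force
    then show "r \<in> ivl R" using S_nonneg[OF \<open>r \<in> S\<close>] by (simp add: ivl_def)
  qed
  \<comment> \<open>any admissible truncation will do, since all of them agree\<close>
  define k where "k r = (SOME K. ok K r)" for r
  have k: "ok (k r) r" if "r \<in> S" for r
    using someI_ex[of "\<lambda>K. ok K r"] that by (simp add: S_def k_def)
  obtain b0 where b0: "b0 \<in> S" "0 < b0" using S_larger[OF \<open>0 \<in> S\<close>] by blast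
  \<comment> \<open>the second derivative at the origin is only determined by the values on an interval of positive length\<close>
  define k' where "k' r = (if r = 0 then k b0 else k r)" for r
  define u v w where "u r = U (k r) r" and "v r = V (k r) r" and "w r = W (k' r) r" for r
  have glue: "u r = U K r \<and> v r = V K r \<and> w r = W K r" if "ok K b" "r \<in> {0..b}" "0 < b" for K b r
  proof -
    have *: "ok K r" "r \<in> S" using ok_mono[OF that(1)] that by (auto simp: S_def)
    have "u r = U K r \<and> v r = V K r"
      using agree[OF k[OF *(2)] *(1), of r] that unfolding u_def v_def by auto
    moreover have "w r = W K r"
    proof (cases "r = 0")
      case True
      have "ok (k b0) (min b b0)" "ok K (min b b0)"
        using ok_mono[OF k[OF b0(1)], of "min b b0"] ok_mono[OF that(1), of "min b b0"] that(3) b0(2) by auto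
      from agreeW[OF this, of r] show ?thesis using True that b0(2) by (simp add: w_def k'_def)
    next
      case False
      then show ?thesis using agreeW[OF k[OF *(2)] *(1), of r] that by (auto simp: w_def k'_def)
    qed
    ultimately show ?thesis by simp
  qed
  have local: "\<exists>K d. 0 < d \<and> (\<forall>x\<in>ivl R. dist x r < d \<longrightarrow> u x = U K x \<and> v x = V K x \<and> w x = W K x)"
    if r: "r \<in> ivl R" for r
  proof -
    obtain b where b: "b \<in> S" "r < b" using r ivl_S S_larger by blast
    have "u x = U (k b) x \<and> v x = V (k b) x \<and> w x = W (k b) x" if "x \<in> ivl R" "dist x r < b - r" for x
      using that b r by (intro glue[OF k[OF b(1)]]) (auto simp: ivl_def dist_real_def)
    then show ?thesis using b(2) by (intro exI[of _ "k b"] exI[of _ "b - r"]) auto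
  qed
  have sub: "ivl R \<subseteq> {0..}" by (auto simp: ivl_def)
  have "radial_ode lam Lam n g (ivl R) u v w"
    unfolding radial_ode_def
  proof (intro conjI ballI impI)
    fix r assume r: "r \<in> ivl R"
    obtain K d where d: "0 < d" "\<And>x. x \<in> ivl R \<Longrightarrow> dist x r < d \<Longrightarrow> u x = U K x \<and> v x = V K x \<and> w x = W K x"
      using local[OF r] by blast
    have r0: "u r = U K r" "v r = V K r" "w r = W K r" using d(2)[OF r] d(1) by auto
    have s: "radial_ode lam Lam n (h K) (ivl R) (U K) (V K) (W K)" by (rule radial_ode_subset[OF sol sub])
    then have "(U K has_real_derivative v r) (at r within ivl R)" "(V K has_real_derivative w r) (at r within ivl R)"
      using r by (auto simp: radial_ode_def r0)
    then show "(u has_real_derivative v r) (at r within ivl R)" "(v has_real_derivative w r) (at r within ivl R)"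
      by - (rule has_field_derivative_transform_within[OF _ d(1) r]; use d(2) in auto)+
  next
    show "continuous_on (ivl R) w"
      unfolding continuous_on_eq_continuous_within
    proof
      fix r assume r: "r \<in> ivl R"
      obtain K d where d: "0 < d" "\<And>x. x \<in> ivl R \<Longrightarrow> dist x r < d \<Longrightarrow> u x = U K x \<and> v x = V K x \<and> w x = W K x"
        using local[OF r] by blast
      have "continuous (at r within ivl R) (W K)"
        using radial_ode_continuous(3)[OF radial_ode_subset[OF sol sub]] r
        by (auto simp: continuous_on_eq_continuous_within)
      then show "continuous (at r within ivl R) w"
        by (rule continuous_transform_within[OF _ d(1) r]) (use d(2) in auto)
    qed
    show "v 0 = 0" using sol by (simp add: v_def radial_ode_def)
  next
    fix r assume r: "r \<in> ivl R" "0 < r"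
    then have ok: "ok (k r) r" using k ivl_S by blast
    then have "u r = U (k r) r" "v r = V (k r) r" "w r = W (k r) r" using glue[OF ok, of r] r(2) by auto
    moreover have "W (k r) r = accel lam Lam n (V (k r) r / r) (h (k r) (U (k r) r))"
      using sol[of "k r"] r by (auto simp: radial_ode_def)
    moreover have "h (k r) (U (k r) r) = g (U (k r) r)"
      using ok r(2) by (auto simp: ok_def h_def clamp_to_id)
    ultimately show "w r = accel lam Lam n (v r / r) (g (u r))" by simp
  qed
  moreover have "0 < R"
    using b0 by (auto simp: R_def less_Sup_iff zero_ereal_def)
  moreover have "u 0 = \<xi>" by (simp add: u_def init)
  moreover have "\<exists>r\<in>ivl R. M < \<bar>u r\<bar>" if "R < \<infinity>" for M
  proof (rule ccontr)
    assume "\<not> (\<exists>r\<in>ivl R. M < \<bar>u r\<bar>)"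
    then have le: "\<bar>u r\<bar> \<le> M" if "r \<in> ivl R" for r using that by force
    obtain K :: nat where K: "M \<le> real K" using real_arch_simple by blast
    obtain \<rho> where \<rho>: "R = ereal \<rho>" "0 < \<rho>"
      using \<open>0 < R\<close> \<open>R < \<infinity>\<close> by (cases R) auto
    have ivl: "ivl R = {0..<\<rho>}" by (auto simp: ivl_def \<rho>)
    have bd: "\<bar>U K r\<bar> \<le> real K" if r: "r \<in> {0..<\<rho>}" for r
    proof -
      obtain b where b: "b \<in> S" "r < b" using r ivl ivl_S S_larger by blast
      have b_eq: "u x = U (k b) x" if "x \<in> {0..b}" for x
        using glue[OF k[OF b(1)] that] b r by auto
      have "U K r = U (k b) r"
      proof (rule agree1[OF k[OF b(1)], THEN conjunct1])
        fix x assume x: "x \<in> {0..b}"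
        then have "x \<in> ivl R" using b(1) ivl_S[of b] by (auto simp: ivl)
        then show "\<bar>U (k b) x\<bar> \<le> real K" using le[of x] b_eq[OF x] K by simp
      qed (use r b in auto)
      also have "\<dots> = u r" using b_eq[of r] r b by simp
      finally show ?thesis using le[of r] r K by (simp add: ivl)
    qed
    have "\<bar>U K r\<bar> \<le> real K" if "r \<in> {0..\<rho>}" for r
    proof (rule continuous_le_on_closure[where S = "{0..<\<rho>}" and f = "\<lambda>r. \<bar>U K r\<bar>"])
      have "continuous_on {0..\<rho>} (U K)"
        using radial_ode_continuous(1)[OF sol[of K]] by (rule continuous_on_subset) auto
      then show "continuous_on (closure {0..<\<rho>}) (\<lambda>r. \<bar>U K r\<bar>)"
        using \<rho>(2) by (auto intro: continuous_intros)
    qed (use that \<rho>(2) bd in auto)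
    then have "ok K \<rho>" using \<rho>(2) by (simp add: ok_def)
    then have "\<rho> \<in> ivl R" unfolding ivl_S S_def by blast
    then show False by (simp add: ivl)
  qed
  ultimately show thesis by (intro that)
qed

text \<open>A proper extension would be continuous, hence bounded, on the compact interval \<open>[0,R]\<close>.\<close>

lemma unbounded_solution_maximal:
  assumes lam: "0 < lam" "lam \<le> Lam"
    and sol: "0 < R" "radial_ode lam Lam (real N - 1) g (ivl R) u v w" "u 0 = \<xi>"
    and blowup: "\<And>M. R < \<infinity> \<Longrightarrow> \<exists>r\<in>ivl R. M < \<bar>u r\<bar>"
  shows "maximal_cauchy_solution lam Lam N g \<xi> R u"
proof -
  have no_extension: False if R': "R < R'" and x: "cauchy_solution lam Lam N g \<xi> R' x" and eq: "\<forall>r\<in>ivl R. x r = u r" for R' x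
  proof -
    have fin: "R < \<infinity>" using R' by (cases R) auto
    obtain \<rho> where \<rho>: "R = ereal \<rho>" "0 < \<rho>"
      using sol(1) fin by (cases R) auto
    obtain y z where "radial_ode lam Lam (real N - 1) g (ivl R') x y z"
      using x unfolding cauchy_solution_iff_radial_ode[OF lam] by blast
    then have "continuous_on (ivl R') x" by (rule radial_ode_continuous)
    moreover have "{0..\<rho>} \<subseteq> ivl R'"
    proof
      fix r assume r: "r \<in> {0..\<rho>}"
      then have "ereal r \<le> R" by (simp add: \<rho>)
      also note R'
      finally show "r \<in> ivl R'" using r by (simp add: ivl_def)
    qed
    ultimately have "continuous_on {0..\<rho>} x" by (rule continuous_on_subset)
    then have "compact (x ` {0..\<rho>})" by (rule compact_continuous_image) simp
    then have "bounded (x ` {0..\<rho>})" by (rule compact_imp_bounded)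
    then obtain B where "\<forall>y\<in>x ` {0..\<rho>}. norm y \<le> B" unfolding bounded_iff by blast
    then have B: "\<bar>x r\<bar> \<le> B" if "r \<in> {0..\<rho>}" for r using that by simp
    obtain r where "r \<in> ivl R" "B < \<bar>u r\<bar>" using blowup[OF fin] by blast
    then show False using B[of r] eq by (auto simp: ivl_def \<rho>)
  qed
  have "cauchy_solution lam Lam N g \<xi> R u"
    using sol cauchy_solution_iff_radial_ode[OF lam] by blast
  then show ?thesis
    unfolding maximal_cauchy_solution_def by (intro conjI notI, assumption, elim exE conjE) (rule no_extension)
qed

section \<open>The anisotropic energy\<close>

lemma ivl_0: "0 < R \<Longrightarrow> 0 \<in> ivl R"
  by (simp add: ivl_def zero_ereal_def[symmetric])

lemma ivl_downward: "r \<in> ivl R \<Longrightarrow> 0 \<le> x \<Longrightarrow> x \<le> r \<Longrightarrow> x \<in> ivl R"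
  by (auto simp: ivl_def intro: le_less_trans[of "ereal x" "ereal r"])

lemma ivl_interior:
  assumes "r \<in> ivl R" "0 < r"
  shows "r \<in> interior (ivl R)"
proof -
  have "ereal r < R" using assms(1) by (simp add: ivl_def)
  from ereal_dense2[OF this] obtain s where s: "ereal r < ereal s" "ereal s < R" by blast
  then have "s \<in> ivl R" using assms(2) by (simp add: ivl_def)
  then have "{0<..<s} \<subseteq> ivl R" using ivl_downward[of s R] by auto
  then show ?thesis by (rule interiorI[rotated 2]) (use s(1) assms(2) in auto)
qed

lemma primitive_0 [simp]: "primitive h 0 = 0"
  by (simp add: primitive_def zero_ereal_def[symmetric])

lemma primitive_has_derivative:
  assumes "continuous_on UNIV h"
  shows "(primitive h has_real_derivative h t) (at t)"
proof -
  define a b where "a = min 0 t - 1" and "b = max 0 t + 1"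
  have "((\<lambda>u. LBINT y=0..u. h y) has_vector_derivative h t) (at t within {a..b})"
    unfolding zero_ereal_def
    by (rule interval_integral_FTC2) (use continuous_on_subset[OF assms] in \<open>auto simp: a_def b_def\<close>)
  moreover have "at t within {a..b} = at t"
    by (rule at_within_interior) (auto simp: a_def b_def)
  ultimately show ?thesis
    by (simp add: has_real_derivative_iff_has_vector_derivative primitive_def[abs_def])
qed

locale radial_problem =
  fixes lam Lam n :: real and g :: "real \<Rightarrow> real" and \<alpha> :: ereal
  assumes lam_pos: "0 < lam" and lam_le: "lam \<le> Lam" and n_pos: "0 < n"
    and g_lipschitz: "local_lipschitz (UNIV :: real set) UNIV (\<lambda>_. g)"
    and g_odd: "g (- t) = - g t"
    and \<alpha>_pos: "0 < \<alpha>"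
    and g_pos: "0 < t \<Longrightarrow> ereal t < \<alpha> \<Longrightarrow> 0 < g t"
    and g_neg: "\<alpha> < ereal t \<Longrightarrow> g t < 0"
    and g_slope: "g field_differentiable at 0" "0 < deriv g 0"
begin

lemma Lam_pos: "0 < Lam" using lam_pos lam_le by simp

lemma g_continuous: "continuous_on UNIV g"
proof (rule continuous_at_imp_continuous_on, rule ballI)
  fix x :: real
  obtain L where "L-lipschitz_on {x-1..x+1} g" using local_lipschitz_Icc[OF g_lipschitz] by blast
  then have "continuous_on {x-1..x+1} g" by (rule lipschitz_on_continuous_on)
  then show "isCont g x" by (rule continuous_on_interior) simp
qed

lemma g_0 [simp]: "g 0 = 0" using g_odd[of 0] by simp

text \<open>The deceleration \<open>- u''\<close> at zero velocity. It is \<open>g / Lam\<close> where \<open>g \<ge> 0\<close> and \<open>g / lam\<close> where \<open>g \<le> 0\<close>; integrating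
  it instead of \<open>g\<close> makes one energy monotone across all sign changes of \<open>u\<close>, \<open>u'\<close> and \<open>u''\<close>.\<close>

definition restoring :: "real \<Rightarrow> real" where
  "restoring t = - pucci_inv lam Lam (- g t)"

definition potential :: "real \<Rightarrow> real" where
  "potential = primitive restoring"

lemma restoring_nonneg_force: "0 \<le> g t \<Longrightarrow> restoring t = g t / Lam"
  by (auto simp: restoring_def pucci_inv_def)

lemma restoring_nonpos_force: "g t \<le> 0 \<Longrightarrow> restoring t = g t / lam"
  by (auto simp: restoring_def pucci_inv_def)

lemma continuous_restoring: "continuous_on UNIV restoring"
  unfolding restoring_def by (intro continuous_intros g_continuous)

lemma potential_has_derivative: "(potential has_real_derivative restoring t) (at t)"
  unfolding potential_def by (rule primitive_has_derivative[OF continuous_restoring])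

lemma potential_0 [simp]: "potential 0 = 0"
  by (simp add: potential_def)

lemma continuous_potential: "continuous_on A potential"
  by (rule DERIV_continuous_on[OF has_field_derivative_at_within[OF potential_has_derivative]])

lemma continuous_primitive_g: "continuous_on A (primitive g)"
  by (rule DERIV_continuous_on[OF has_field_derivative_at_within[OF primitive_has_derivative[OF g_continuous]]])

lemma potential_eq_pos:
  assumes "0 \<le> t" "ereal t \<le> \<alpha>"
  shows "potential t = primitive g t / Lam"
proof (cases "t = 0")
  case False
  have "potential t - primitive g t / Lam = potential 0 - primitive g 0 / Lam"
  proof (rule DERIV_isconst_end[where f = "\<lambda>t. potential t - primitive g t / Lam"])
    fix x assume x: "0 < x" "x < t"
    then have "ereal x < \<alpha>" using assms(2) by (meson ereal_less_eq(3) less_le_trans less_ereal.simps(1))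
    then have "restoring x = g x / Lam" using g_pos[of x] x by (intro restoring_nonneg_force) simp
    then show "((\<lambda>t. potential t - primitive g t / Lam) has_real_derivative 0) (at x)"
      using Lam_pos by (auto intro!: derivative_eq_intros potential_has_derivative primitive_has_derivative g_continuous)
  qed (use False assms Lam_pos in \<open>auto intro!: continuous_intros continuous_potential continuous_primitive_g\<close>)
  then show ?thesis by simp
qed simp

lemma potential_eq_neg:
  assumes "t \<le> 0" "ereal (- t) \<le> \<alpha>"
  shows "potential t = primitive g t / lam"
proof (cases "t = 0")
  case False
  have "potential 0 - primitive g 0 / lam = potential t - primitive g t / lam"
  proof (rule DERIV_isconst_end[where f = "\<lambda>t. potential t - primitive g t / lam"])
    fix x assume x: "t < x" "x < 0"
    then have "ereal (- x) < ereal (- t)" by simp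
    then have "ereal (- x) < \<alpha>" using assms(2) by (rule less_le_trans)
    then have "restoring x = g x / lam" using g_pos[of "- x"] g_odd[of x] x by (intro restoring_nonpos_force) simp
    then show "((\<lambda>t. potential t - primitive g t / lam) has_real_derivative 0) (at x)"
      using lam_pos by (auto intro!: derivative_eq_intros potential_has_derivative primitive_has_derivative g_continuous)
  qed (use False assms lam_pos in \<open>auto intro!: continuous_intros continuous_potential continuous_primitive_g\<close>)
  then show ?thesis by simp
qed simp

lemma potential_strict_mono:
  assumes "0 \<le> s" "s < t" "ereal t \<le> \<alpha>"
  shows "potential s < potential t"
proof (rule DERIV_pos_imp_increasing_open[OF assms(2)])
  fix x assume x: "s < x" "x < t"
  then have "ereal x < ereal t" by simp
  then have "ereal x < \<alpha>" using assms(3) by (rule less_le_trans)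
  then have "0 < g x" using g_pos[of x] x assms by simp
  then have "0 < restoring x" using restoring_nonneg_force[of x] Lam_pos by simp
  then show "\<exists>y. (potential has_real_derivative y) (at x) \<and> 0 < y"
    using potential_has_derivative by blast
qed (rule continuous_potential)

text \<open>The left wall of the well is the higher one, since \<open>restoring\<close> carries the factor \<open>1/lam\<close> there.\<close>

lemma potential_reflect:
  assumes "0 \<le> t" "ereal t \<le> \<alpha>"
  shows "potential t \<le> potential (- t)"
proof -
  have "potential (- 0) - potential 0 \<le> potential (- t) - potential t"
  proof (rule DERIV_nonneg_imp_increasing_open[OF assms(1)])
    fix x assume x: "0 < x" "x < t"
    then have "ereal x < ereal t" by simp
    then have "ereal x < \<alpha>" using assms(2) by (rule less_le_trans)
    then have g: "0 < g x" using g_pos[of x] x by simp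
    have "((\<lambda>t. potential (- t) - potential t) has_real_derivative - restoring (- x) - restoring x) (at x)"
      by (rule derivative_eq_intros DERIV_chain'[OF _ potential_has_derivative] potential_has_derivative refl)+ simp
    moreover have "- restoring (- x) - restoring x = g x / lam - g x / Lam"
      using g by (simp add: restoring_nonneg_force restoring_nonpos_force g_odd)
    moreover have "g x / Lam \<le> g x / lam" using g lam_pos lam_le by (intro divide_left_mono) auto
    ultimately show "\<exists>y. ((\<lambda>t. potential (- t) - potential t) has_real_derivative y) (at x) \<and> 0 \<le> y"
      by (intro exI[of _ "- restoring (- x) - restoring x"]) simp
  qed (intro continuous_intros continuous_on_compose2[OF continuous_potential[of UNIV]] continuous_potential; simp)
  then show ?thesis by simp
qed

definition energy :: "(real \<Rightarrow> real) \<Rightarrow> (real \<Rightarrow> real) \<Rightarrow> real \<Rightarrow> real" where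
  "energy u v r = (v r)\<^sup>2 / 2 + potential (u r)"

abbreviation solves :: "real set \<Rightarrow> (real \<Rightarrow> real) \<Rightarrow> (real \<Rightarrow> real) \<Rightarrow> (real \<Rightarrow> real) \<Rightarrow> bool" where
  "solves \<equiv> radial_ode lam Lam n g"

text \<open>By definition of the potential, \<open>E' = u' (A(u'/r, g(u)) - A(0, g(u)))\<close>, and \<open>A\<close> decreases in its first
  argument at least at the rate \<open>n lam / Lam\<close>.\<close>

lemma energy_dissipation:
  assumes "solves I u v w" "r \<in> interior I" "0 < r"
  shows "\<exists>D. (energy u v has_real_derivative D) (at r) \<and> D \<le> - (n * lam / Lam) * (v r)\<^sup>2 / r"
proof -
  note d = radial_ode_deriv_interior[OF assms(1,2)]
  have D: "(energy u v has_real_derivative v r * w r + restoring (u r) * v r) (at r)"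
    unfolding energy_def
    by (rule DERIV_cong[OF DERIV_add[OF DERIV_cdivide[OF DERIV_power[OF d(2), of 2], of 2]
            DERIV_chain2[OF potential_has_derivative d(1)]]]) simp
  have "w r = accel lam Lam n (v r / r) (g (u r))"
    using assms interior_subset[of I] by (auto simp: radial_ode_def)
  then have w: "v r * w r + restoring (u r) * v r
      = r * ((accel lam Lam n (v r / r) (g (u r)) - accel lam Lam n 0 (g (u r))) * (v r / r - 0))"
    unfolding restoring_def accel_zero_slope using \<open>0 < r\<close> by (simp add: algebra_simps)
  have "(accel lam Lam n (v r / r) (g (u r)) - accel lam Lam n 0 (g (u r))) * (v r / r - 0)
     \<le> - (n * lam / Lam) * (v r / r - 0)\<^sup>2"
    by (rule accel_dissipative[OF lam_pos lam_le]) (use n_pos in simp)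
  then have "v r * w r + restoring (u r) * v r \<le> r * (- (n * lam / Lam) * (v r / r - 0)\<^sup>2)"
    unfolding w using \<open>0 < r\<close> by (intro mult_left_mono) auto
  also have "\<dots> = - (n * lam / Lam) * (v r)\<^sup>2 / r"
    using \<open>0 < r\<close> by (simp add: power2_eq_square)
  finally show ?thesis using D by blast
qed

lemma continuous_energy:
  assumes "solves I u v w" "J \<subseteq> I"
  shows "continuous_on J (energy u v)"
  unfolding energy_def
  using radial_ode_continuous[OF radial_ode_subset[OF assms]]
  by (intro continuous_intros continuous_on_compose2[OF continuous_potential[of UNIV]]) auto

lemma energy_antimono:
  assumes sol: "solves I u v w" and "0 \<le> a" "a \<le> b" "{a..b} \<subseteq> I"
  shows "energy u v b \<le> energy u v a"
proof (rule DERIV_nonpos_imp_decreasing_open[OF \<open>a \<le> b\<close>])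
  fix x assume x: "a < x" "x < b"
  then have "x \<in> interior {a..b}" by simp
  then have "x \<in> interior I" using interior_mono[OF \<open>{a..b} \<subseteq> I\<close>] by blast
  from energy_dissipation[OF sol this] x \<open>0 \<le> a\<close>
  obtain D where D: "(energy u v has_real_derivative D) (at x)" "D \<le> - (n * lam / Lam) * (v x)\<^sup>2 / x"
    by auto
  have "0 \<le> (n * lam / Lam) * (v x)\<^sup>2 / x"
    using x \<open>0 \<le> a\<close> n_pos lam_pos Lam_pos by simp
  then show "\<exists>y. (energy u v has_real_derivative y) (at x) \<and> y \<le> 0"
    using D by (intro exI[of _ D]) auto
qed (rule continuous_energy[OF sol \<open>{a..b} \<subseteq> I\<close>])

text \<open>Constant energy would force \<open>u' = 0\<close>, so \<open>u\<close> would rest at a point where the force does not vanish.\<close>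

lemma energy_strict_decrease:
  assumes sol: "solves I u v w" and b: "0 < b" "{0..b} \<subseteq> I" and "g (u 0) \<noteq> 0"
  shows "energy u v b < energy u v 0"
proof (rule ccontr)
  assume contra: "\<not> energy u v b < energy u v 0"
  have const: "energy u v x = energy u v 0" if "x \<in> {0..b}" for x
  proof (rule antisym)
    have "{0..x} \<subseteq> I" "{x..b} \<subseteq> I" using that b(2) by auto
    then have "energy u v x \<le> energy u v 0" "energy u v b \<le> energy u v x"
      using that by (auto intro: energy_antimono[OF sol])
    then show "energy u v x \<le> energy u v 0" "energy u v 0 \<le> energy u v x"
      using contra by auto
  qed
  have int: "x \<in> interior I" if "0 < x" "x < b" for x
    using interior_mono[OF b(2)] that by auto
  have v0: "v x = 0" if x: "0 < x" "x < b" for x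
  proof -
    obtain D where D: "(energy u v has_real_derivative D) (at x)" "D \<le> - (n * lam / Lam) * (v x)\<^sup>2 / x"
      using energy_dissipation[OF sol int[OF x] x(1)] by blast
    have "eventually (\<lambda>x. x \<in> {0<..<b}) (nhds x)"
      by (rule eventually_nhds_in_open) (use x in auto)
    then have "eventually (\<lambda>x. energy u v x = energy u v 0) (nhds x)"
      by eventually_elim (rule const, simp)
    then have "(energy u v has_real_derivative D) (at x) \<longleftrightarrow> ((\<lambda>_. energy u v 0) has_real_derivative D) (at x)"
      by (intro DERIV_cong_ev refl)
    then have "((\<lambda>_. energy u v 0) has_real_derivative D) (at x)" using D(1) by blast
    then have "D = 0" using DERIV_unique[OF _ DERIV_const] by blast
    then have "n * lam / Lam * (v x)\<^sup>2 / x \<le> 0" using D(2) by simp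
    then show ?thesis
      using x n_pos lam_pos Lam_pos by (simp add: divide_le_0_iff mult_le_0_iff)
  qed
  define x where "x = b / 2"
  have x: "0 < x" "x < b" using b(1) by (auto simp: x_def)
  have "u x = u 0"
  proof (rule DERIV_isconst_end[OF x(1)])
    show "continuous_on {0..x} u"
      by (rule continuous_on_subset[OF radial_ode_continuous(1)[OF sol]]) (use x b in auto)
    show "(u has_real_derivative 0) (at y)" if "0 < y" "y < x" for y
      using radial_ode_deriv_interior(1)[OF sol int, of y] v0[of y] that x by simp
  qed
  have "eventually (\<lambda>x. x \<in> {0<..<b}) (nhds x)"
    by (rule eventually_nhds_in_open) (use x in auto)
  then have "eventually (\<lambda>x. v x = 0) (nhds x)" by eventually_elim (use v0 in auto)
  then have "(v has_real_derivative w x) (at x) \<longleftrightarrow> ((\<lambda>_. 0) has_real_derivative w x) (at x)"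
    by (intro DERIV_cong_ev refl)
  then have "((\<lambda>_. 0) has_real_derivative w x) (at x)"
    using radial_ode_deriv_interior(2)[OF sol int[OF x]] by blast
  then have "w x = 0" using DERIV_unique[OF _ DERIV_const] by blast
  moreover have "w x = accel lam Lam n (v x / x) (g (u x))"
    using sol b x subsetD[OF b(2), of x] by (simp add: radial_ode_def)
  ultimately have "pucci_inv lam Lam (- g (u 0)) = 0"
    using v0[OF x] \<open>u x = u 0\<close> by (simp add: accel_zero_slope)
  then show False
    using assms(4) lam_pos Lam_pos by (auto simp: pucci_inv_def split: if_splits)
qed

text \<open>To leave \<open>(-\<eta>, \<eta>)\<close> the solution has to pass through \<open>\<eta>\<close> or \<open>-\<eta>\<close>, where the potential alone exceeds the
  energy available at \<open>r0\<close>.\<close>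

lemma energy_barrier:
  assumes sol: "solves (ivl R) u v w" and r0: "r0 \<in> ivl R" "\<bar>u r0\<bar> < \<eta>" "energy u v r0 < potential \<eta>"
    and \<eta>: "ereal \<eta> \<le> \<alpha>" and r: "r \<in> ivl R" "r0 \<le> r"
  shows "\<bar>u r\<bar> < \<eta>"
proof (rule ccontr)
  assume "\<not> \<bar>u r\<bar> < \<eta>"
  have sub: "{r0..r} \<subseteq> ivl R"
    using r0(1) ivl_downward[OF r(1)] by (auto simp: ivl_def)
  have "continuous_on {r0..r} u"
    by (rule continuous_on_subset[OF radial_ode_continuous(1)[OF sol] sub])
  then have "\<exists>x\<ge>r0. x \<le> r \<and> \<bar>u x\<bar> = \<eta>"
    using r0(2) \<open>\<not> \<bar>u r\<bar> < \<eta>\<close> r(2) by (intro IVT'[where f = "\<lambda>x. \<bar>u x\<bar>"] continuous_intros) auto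
  then obtain x where x: "r0 \<le> x" "x \<le> r" "\<bar>u x\<bar> = \<eta>" by blast
  have "potential \<eta> \<le> potential (u x)"
    using x(3) potential_reflect[of \<eta>] \<eta> by (cases "0 \<le> u x") auto
  also have "\<dots> \<le> energy u v x" by (simp add: energy_def)
  also have "\<dots> \<le> energy u v r0"
  proof (rule energy_antimono[OF sol _ x(1)])
    show "0 \<le> r0" using r0(1) by (simp add: ivl_def)
    show "{r0..x} \<subseteq> ivl R" using x(2) sub by auto
  qed
  finally show False using r0(3) by simp
qed

text \<open>Every level \<open>\<eta>\<close> in \<open>(u(0), \<alpha>)\<close> is a barrier for the initial energy \<open>\<Gamma>(u(0))\<close>.\<close>

lemma amplitude_bounded_by_positive_start:
  assumes sol: "solves (ivl R) u v w" and "0 < R" and u0: "0 < u 0" "ereal (u 0) < \<alpha>" and r: "r \<in> ivl R"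
  shows "\<bar>u r\<bar> \<le> u 0"
proof (rule ccontr)
  assume "\<not> \<bar>u r\<bar> \<le> u 0"
  then have "ereal (u 0) < min \<alpha> (ereal \<bar>u r\<bar>)" using u0(2) by simp
  then obtain \<eta> where "ereal (u 0) < ereal \<eta>" "ereal \<eta> < min \<alpha> (ereal \<bar>u r\<bar>)"
    using ereal_dense2 by blast
  then have \<eta>: "u 0 < \<eta>" "ereal \<eta> < \<alpha>" "\<eta> < \<bar>u r\<bar>" by auto
  have "v 0 = 0" using sol by (simp add: radial_ode_def)
  then have "energy u v 0 < potential \<eta>"
    using potential_strict_mono[of "u 0" \<eta>] u0 \<eta> by (simp add: energy_def)
  from energy_barrier[OF sol ivl_0[OF \<open>0 < R\<close>] _ this less_imp_le[OF \<eta>(2)] r] \<eta> u0 r show False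
    by (auto simp: ivl_def)
qed

text \<open>On \<open>[0,\<alpha>]\<close> the potential is \<open>G / Lam\<close>, and \<open>G(\<alpha>)\<close> is approached from the left: by continuity if \<open>\<alpha>\<close> is
  finite, and as the limit of a monotone function otherwise.\<close>

lemma potential_exceeds_below_limit:
  assumes "ereal (Lam * e) < primitive_ext g \<alpha>"
  obtains \<eta> where "0 \<le> \<eta>" "ereal \<eta> < \<alpha>" "e < potential \<eta>"
proof (cases "\<alpha> = \<infinity>")
  case True
  define l where "l = (SUP t\<in>{0..}. ereal (primitive g t))"
  have mono: "primitive g s \<le> primitive g t" if "0 \<le> s" "s \<le> t" for s t
    using potential_strict_mono[of s t] potential_eq_pos[of s] potential_eq_pos[of t] that Lam_pos True
    by (cases "s = t") (auto simp: divide_less_cancel)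
  have "((\<lambda>t. ereal (primitive g t)) \<longlongrightarrow> l) at_top"
  proof (rule increasing_tendsto)
    show "eventually (\<lambda>t. ereal (primitive g t) \<le> l) at_top"
      using eventually_ge_at_top[of 0] by eventually_elim (auto simp: l_def intro: SUP_upper)
    fix x assume "x < l"
    then obtain t0 where t0: "0 \<le> t0" "x < ereal (primitive g t0)" by (auto simp: l_def less_SUP_iff)
    show "eventually (\<lambda>t. x < ereal (primitive g t)) at_top"
      using eventually_ge_at_top[of t0]
    proof eventually_elim
      case (elim t)
      have "ereal (primitive g t0) \<le> ereal (primitive g t)" using mono[OF t0(1) elim] by simp
      with t0(2) show ?case by (rule less_le_trans)
    qed
  qed
  then have "primitive_ext g \<alpha> = l"
    using True by (simp add: primitive_ext_def tendsto_Lim)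
  then obtain t where t: "0 \<le> t" "ereal (Lam * e) < ereal (primitive g t)"
    using assms by (auto simp: l_def less_SUP_iff)
  then have "e < potential t"
    using potential_eq_pos[of t] True Lam_pos by (simp add: pos_less_divide_eq mult.commute)
  then show thesis using that[of t] t True by simp
next
  case False
  then obtain a where a: "\<alpha> = ereal a" "0 < a" using \<alpha>_pos by (cases \<alpha>) auto
  have "e < potential a"
    using assms potential_eq_pos[of a] a Lam_pos
    by (simp add: primitive_ext_def pos_less_divide_eq mult.commute)
  moreover have "(potential \<longlongrightarrow> potential a) (at_left a)"
    using DERIV_isCont[OF potential_has_derivative, of a] tendsto_within_subset[OF _ subset_UNIV]
    by (auto simp: isCont_def)
  ultimately have "eventually (\<lambda>x. e < potential x) (at_left a)"
    by (simp add: order_tendstoD)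
  moreover have "eventually (\<lambda>x. x \<in> {0<..<a}) (at_left a)"
    by (rule eventually_at_leftI[OF _ a(2)])
  ultimately have "eventually (\<lambda>x. e < potential x \<and> x \<in> {0<..<a}) (at_left a)"
    by eventually_elim auto
  then obtain x where "e < potential x" "x \<in> {0<..<a}"
    using eventually_happens'[of "at_left a"] by auto
  then show thesis using that[of x] a by auto
qed

text \<open>The hypothesis permits equality, in which case no level below \<open>\<alpha>\<close> is a barrier for the initial energy.
  After a short time \<open>r0\<close>, during which the solution stays near \<open>u(0)\<close>, the energy has dropped strictly and
  a barrier below \<open>\<alpha>\<close> exists.\<close>

lemma trapped_from_below:
  assumes sol: "solves (ivl R) u v w" and "0 < R" and u0: "u 0 \<noteq> 0" "ereal \<bar>u 0\<bar> < \<alpha>"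
    and bound: "ereal (Lam * potential (u 0)) \<le> primitive_ext g \<alpha>"
  obtains M where "0 < M" "ereal M < \<alpha>" "\<And>r. r \<in> ivl R \<Longrightarrow> \<bar>u r\<bar> \<le> M"
proof -
  have u_cont: "continuous_on (ivl R) u" by (rule radial_ode_continuous[OF sol])
  from ereal_dense2[OF u0(2)] obtain M1 where "ereal \<bar>u 0\<bar> < ereal M1" "ereal M1 < \<alpha>" by blast
  then have M1: "\<bar>u 0\<bar> < M1" "ereal M1 < \<alpha>" by simp_all
  have "0 < M1 - \<bar>u 0\<bar>" using M1(1) by simp
  from u_cont[unfolded continuous_on_iff, rule_format, OF ivl_0[OF \<open>0 < R\<close>] this]
  obtain d where d: "0 < d" "\<forall>x\<in>ivl R. dist x 0 < d \<longrightarrow> dist (u x) (u 0) < M1 - \<bar>u 0\<bar>"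
    by blast
  have "0 < min R (ereal d)" using \<open>0 < R\<close> d(1) by simp
  from ereal_dense2[OF this] obtain r0 where "0 < ereal r0" "ereal r0 < min R (ereal d)" by blast
  then have r0: "0 < r0" "r0 \<in> ivl R" "r0 < d" by (auto simp: ivl_def)
  have sub: "{0..r0} \<subseteq> ivl R"
    using ivl_downward[OF r0(2)] by auto
  have near: "\<bar>u x\<bar> < M1" if "x \<in> {0..r0}" for x
    using bspec[OF d(2), of x] that sub r0 by (auto simp: dist_real_def)
  have "v 0 = 0" using sol by (simp add: radial_ode_def)
  have "g (u 0) \<noteq> 0"
    using g_pos[of "\<bar>u 0\<bar>"] u0 g_odd[of "u 0"] by (auto simp: abs_if split: if_splits)
  then have "energy u v r0 < energy u v 0"
    by (rule energy_strict_decrease[OF sol r0(1) sub])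
  then have "energy u v r0 < potential (u 0)" using \<open>v 0 = 0\<close> by (simp add: energy_def)
  then have "ereal (Lam * energy u v r0) < ereal (Lam * potential (u 0))" using Lam_pos by simp
  then have "ereal (Lam * energy u v r0) < primitive_ext g \<alpha>" using bound by (rule less_le_trans)
  then obtain \<eta> where \<eta>: "0 \<le> \<eta>" "ereal \<eta> < \<alpha>" "energy u v r0 < potential \<eta>"
    by (rule potential_exceeds_below_limit)
  define M where "M = max \<eta> M1"
  have M: "0 < M" "ereal M < \<alpha>" using \<eta> M1 by (auto simp: M_def max_def)
  have "potential \<eta> \<le> potential M"
    using potential_strict_mono[OF \<eta>(1) _ less_imp_le[OF M(2)]] by (cases "\<eta> < M1") (auto simp: M_def max_def)
  then have E: "energy u v r0 < potential M" using \<eta>(3) by simp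
  have "\<bar>u r\<bar> \<le> M" if r: "r \<in> ivl R" for r
  proof (cases "r \<le> r0")
    case True
    then show ?thesis using near[of r] r by (auto simp: ivl_def M_def)
  next
    case False
    have "\<bar>u r0\<bar> < M" using near[of r0] r0 by (auto simp: M_def)
    from energy_barrier[OF sol r0(2) this E less_imp_le[OF M(2)] r] False show ?thesis by auto
  qed
  then show thesis using that M by blast
qed

end

section \<open>Oscillation\<close>

text \<open>A Sturm type argument: \<open>q = - v/u\<close> satisfies \<open>q' \<ge> c + q\<^sup>2 - (k/r) |q| \<ge> (c + q\<^sup>2)/2\<close> once \<open>(k/r)\<^sup>2 \<le> c\<close>,
  so that \<open>arctan q\<close> would grow at least linearly.\<close>

lemma linear_damping_forces_zero:
  fixes u v w :: "real \<Rightarrow> real"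
  assumes c: "0 < c" and k: "0 \<le> k" and r1: "0 < r1"
    and du: "\<And>r. r1 \<le> r \<Longrightarrow> (u has_real_derivative v r) (at r)"
    and dv: "\<And>r. r1 \<le> r \<Longrightarrow> (v has_real_derivative w r) (at r)"
    and ineq: "\<And>r. r1 \<le> r \<Longrightarrow> u r * w r \<le> - c * (u r)\<^sup>2 + k / r * \<bar>u r * v r\<bar>"
  shows "\<exists>r\<ge>r1. u r = 0"
proof (rule ccontr)
  assume "\<not> (\<exists>r\<ge>r1. u r = 0)"
  then have nz: "u r \<noteq> 0" if "r1 \<le> r" for r using that by auto
  define q where "q r = - v r / u r" for r
  define m where "m = min c 1 / 2"
  have m: "0 < m" "m \<le> c / 2" "m \<le> 1 / 2" using c by (auto simp: m_def)
  \<comment> \<open>beyond this point \<open>(k/r)\<^sup>2 \<le> c\<close>\<close>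
  define r2 where "r2 = max r1 (k / sqrt c)"
  have arctan_growth: "\<exists>D. ((\<lambda>r. arctan (q r) - m * r) has_real_derivative D) (at r) \<and> 0 \<le> D" if r: "r2 \<le> r" for r
  proof -
    have rr: "r1 \<le> r" "0 < r" "k / sqrt c \<le> r" using r r1 by (auto simp: r2_def)
    note nz = nz[OF rr(1)]
    define q' where "q' = (q r)\<^sup>2 - w r / u r"
    have "- ((w r * u r - v r * v r) / (u r * u r)) = q'"
      using nz by (simp add: q'_def q_def field_simps power2_eq_square)
    then have dq: "(q has_real_derivative q') (at r)"
      using DERIV_minus[OF DERIV_divide[OF dv[OF rr(1)] du[OF rr(1)] nz]]
      by (simp add: q_def[abs_def])
    have uu: "0 < (u r)\<^sup>2" using nz by simp
    have "u r * v r = - ((u r)\<^sup>2 * q r)" using nz by (simp add: q_def power2_eq_square)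
    then have "\<bar>u r * v r\<bar> = (u r)\<^sup>2 * \<bar>q r\<bar>" by (simp add: abs_mult)
    moreover have "u r * w r = (u r)\<^sup>2 * (w r / u r)" using nz by (simp add: power2_eq_square)
    ultimately have "(u r)\<^sup>2 * (w r / u r) \<le> (u r)\<^sup>2 * (- c + k / r * \<bar>q r\<bar>)"
      using ineq[OF rr(1)] by (simp add: algebra_simps)
    then have "w r / u r \<le> - c + k / r * \<bar>q r\<bar>" using uu by (simp only: mult_le_cancel_left_pos)
    then have "c + (q r)\<^sup>2 - k / r * \<bar>q r\<bar> \<le> q'" by (simp add: q'_def)
    moreover have "2 * (k / r * \<bar>q r\<bar>) \<le> (k / r)\<^sup>2 + (q r)\<^sup>2"
      using sum_squares_bound[of "k / r" "\<bar>q r\<bar>"] by simp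
    moreover have "(k / r)\<^sup>2 \<le> c"
    proof -
      have "k / r \<le> sqrt c" using rr c by (simp add: field_simps)
      then have "(k / r)\<^sup>2 \<le> (sqrt c)\<^sup>2" using k rr by (intro power_mono) auto
      then show ?thesis using c by simp
    qed
    ultimately have "c / 2 + (q r)\<^sup>2 / 2 \<le> q'" by linarith
    moreover have "m * (q r)\<^sup>2 \<le> 1 / 2 * (q r)\<^sup>2" using m by (intro mult_right_mono) auto
    ultimately have "m * (1 + (q r)\<^sup>2) \<le> q'" using m by (simp add: distrib_left)
    moreover have pos: "0 < 1 + (q r)\<^sup>2" by (simp add: add_pos_nonneg)
    ultimately have "m \<le> q' / (1 + (q r)\<^sup>2)" by (simp add: pos_le_divide_eq)
    moreover have "((\<lambda>r. arctan (q r) - m * r) has_real_derivative inverse (1 + (q r)\<^sup>2) * q' - m) (at r)"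
      using DERIV_diff[OF DERIV_chain2[OF DERIV_arctan dq] DERIV_cmult_Id[of m]] .
    ultimately show ?thesis
      by (intro exI[of _ "inverse (1 + (q r)\<^sup>2) * q' - m"]) (simp add: divide_inverse mult.commute)
  qed
  \<comment> \<open>on an interval of length \<open>pi / m\<close> the function \<open>arctan q\<close> would grow by \<open>pi\<close>\<close>
  define R where "R = r2 + pi / m"
  have "r2 \<le> R" using m by (simp add: R_def)
  then have "arctan (q r2) - m * r2 \<le> arctan (q R) - m * R"
    by (rule DERIV_nonneg_imp_nondecreasing) (use arctan_growth in auto)
  moreover have "m * R = m * r2 + pi" using m by (simp add: R_def distrib_left)
  ultimately show False using arctan_lbound[of "q r2"] arctan_ubound[of "q R"] by simp
qed

lemma nondecreasing_away_from_0:
  fixes F D :: "real \<Rightarrow> real"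
  assumes d: "\<And>x. (F has_real_derivative D x) (at x)"
    and sgn: "\<And>x. \<bar>x\<bar> \<le> M \<Longrightarrow> 0 \<le> x * D x" and t: "\<bar>t\<bar> \<le> M"
  shows "F 0 \<le> F t"
proof (cases "0 \<le> t")
  case True
  have cont: "continuous_on {0..t} F" by (rule DERIV_continuous_on[OF has_field_derivative_at_within[OF d]])
  have "\<exists>y. (F has_real_derivative y) (at x) \<and> 0 \<le> y" if "0 < x" "x < t" for x
    using d[of x] sgn[of x] that t by (intro exI[of _ "D x"]) (auto simp: zero_le_mult_iff)
  from DERIV_nonneg_imp_increasing_open[OF True this cont] show ?thesis .
next
  case False
  then have t0: "t \<le> 0" by simp
  have cont: "continuous_on {t..0} F" by (rule DERIV_continuous_on[OF has_field_derivative_at_within[OF d]])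
  have "\<exists>y. (F has_real_derivative y) (at x) \<and> y \<le> 0" if "t < x" "x < 0" for x
    using d[of x] sgn[of x] that t by (intro exI[of _ "D x"]) (auto simp: zero_le_mult_iff)
  from DERIV_nonpos_imp_decreasing_open[OF t0 this cont] show ?thesis .
qed

context radial_problem
begin

text \<open>This is where \<open>g'(0) > 0\<close> enters: near \<open>0\<close> the quotient \<open>g(t)/t\<close> stays above a positive constant by
  differentiability, and on the rest of \<open>[0, M]\<close> by compactness.\<close>

lemma g_superlinear:
  assumes "0 < M" "ereal M < \<alpha>"
  obtains c where "0 < c" "\<And>t. 0 \<le> t \<Longrightarrow> t \<le> M \<Longrightarrow> c * t \<le> g t"
proof -
  define d where "d = deriv g 0"
  have "(g has_real_derivative d) (at 0)"
    using g_slope(1) by (simp add: d_def DERIV_deriv_iff_field_differentiable)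
  then have "((\<lambda>t. g t / t) \<longlongrightarrow> d) (at 0)" by (simp add: has_field_derivative_iff)
  then have "eventually (\<lambda>t. d / 2 < g t / t) (at 0)"
    using g_slope(2) by (intro order_tendstoD) (auto simp: d_def)
  then obtain e where e: "0 < e" "\<And>t. t \<noteq> 0 \<Longrightarrow> dist t 0 < e \<Longrightarrow> d / 2 < g t / t"
    unfolding eventually_at by auto
  define b where "b = min M (e / 2)"
  have b: "0 < b" "b \<le> M" "b < e" using e(1) assms(1) by (auto simp: b_def)
  have "continuous_on {b..M} (\<lambda>t. g t / t)"
    using b by (intro continuous_intros continuous_on_subset[OF g_continuous subset_UNIV]) auto
  then obtain s where s: "s \<in> {b..M}" "\<And>t. t \<in> {b..M} \<Longrightarrow> g s / s \<le> g t / t"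
    using continuous_attains_inf[of "{b..M}" "\<lambda>t. g t / t"] b by auto
  have "ereal s \<le> ereal M" using s(1) by simp
  then have "ereal s < \<alpha>" using assms(2) by (rule le_less_trans)
  then have "0 < g s / s" using g_pos[of s] s(1) b by simp
  define c where "c = min (d / 2) (g s / s)"
  have "c * t \<le> g t" if t: "0 \<le> t" "t \<le> M" for t
  proof (cases "t = 0")
    case False
    have "c \<le> g t / t"
    proof (cases "t < e")
      case True
      then have "d / 2 < g t / t" using False t by (intro e(2)) (auto simp: dist_real_def)
      then show ?thesis unfolding c_def by linarith
    next
      case False
      then show ?thesis using s(2)[of t] t b by (simp add: c_def)
    qed
    then show ?thesis using False t by (simp add: pos_le_divide_eq)
  qed simp
  moreover have "0 < c" using g_slope(2) \<open>0 < g s / s\<close> by (simp add: c_def d_def)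
  ultimately show thesis using that by blast
qed

lemma restoring_coercive:
  assumes "0 < M" "ereal M < \<alpha>"
  obtains c where "0 < c" "\<And>t. \<bar>t\<bar> \<le> M \<Longrightarrow> c * t\<^sup>2 \<le> t * restoring t"
proof -
  obtain c where c: "0 < c" "\<And>t. 0 \<le> t \<Longrightarrow> t \<le> M \<Longrightarrow> c * t \<le> g t" using g_superlinear[OF assms] by blast
  have "c / Lam * t\<^sup>2 \<le> t * restoring t" if t: "\<bar>t\<bar> \<le> M" for t
  proof -
    have *: "c * \<bar>t\<bar> \<le> g \<bar>t\<bar>" using c(2)[of "\<bar>t\<bar>"] t by simp
    have "0 \<le> c * \<bar>t\<bar>" using c(1) by simp
    then have g0: "0 \<le> g \<bar>t\<bar>" using * by simp
    have "g \<bar>t\<bar> / Lam \<le> \<bar>restoring t\<bar>" "t * restoring t = \<bar>t\<bar> * \<bar>restoring t\<bar>"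
    proof (atomize(full), cases "0 \<le> t")
      case True
      then show "g \<bar>t\<bar> / Lam \<le> \<bar>restoring t\<bar> \<and> t * restoring t = \<bar>t\<bar> * \<bar>restoring t\<bar>"
        using restoring_nonneg_force[of t] g0 Lam_pos by simp
    next
      case False
      then have g: "g \<bar>t\<bar> = - g t" using g_odd[of t] by simp
      have "g \<bar>t\<bar> / Lam \<le> g \<bar>t\<bar> / lam" using g0 lam_pos lam_le by (intro divide_left_mono) auto
      moreover have r: "restoring t = - (g \<bar>t\<bar> / lam)"
        using restoring_nonpos_force[of t] g0 unfolding g by simp
      moreover have "0 \<le> g \<bar>t\<bar> / lam" using g0 lam_pos by simp
      then have "\<bar>restoring t\<bar> = g \<bar>t\<bar> / lam" unfolding r abs_minus_cancel by (rule abs_of_nonneg)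
      ultimately show "g \<bar>t\<bar> / Lam \<le> \<bar>restoring t\<bar> \<and> t * restoring t = \<bar>t\<bar> * \<bar>restoring t\<bar>"
        using False by (simp add: abs_of_neg[of t])
    qed
    moreover have "c * \<bar>t\<bar> / Lam \<le> g \<bar>t\<bar> / Lam" using * Lam_pos by (intro divide_right_mono) auto
    ultimately have "c * \<bar>t\<bar> / Lam \<le> \<bar>restoring t\<bar>" "t * restoring t = \<bar>t\<bar> * \<bar>restoring t\<bar>" by auto
    from mult_left_mono[OF this(1), of "\<bar>t\<bar>"] this(2)
    have "\<bar>t\<bar> * (c * \<bar>t\<bar> / Lam) \<le> t * restoring t" by simp
    moreover have "\<bar>t\<bar> * (c * \<bar>t\<bar> / Lam) = c / Lam * (\<bar>t\<bar> * \<bar>t\<bar>)"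
      by simp
    ultimately show ?thesis by (simp only: abs_mult_self_eq power2_eq_square)
  qed
  moreover have "0 < c / Lam" using c(1) Lam_pos by simp
  ultimately show thesis using that by blast
qed

lemma restoring_linear_bound:
  obtains L where "0 < L" "\<And>t. \<bar>t\<bar> \<le> M \<Longrightarrow> \<bar>restoring t\<bar> \<le> L * \<bar>t\<bar>"
proof -
  obtain L where L: "L-lipschitz_on {- M..M} g" using local_lipschitz_Icc[OF g_lipschitz] by blast
  have L0: "0 \<le> L" using L by (rule lipschitz_on_nonneg)
  have "\<bar>restoring t\<bar> \<le> (L / lam + 1) * \<bar>t\<bar>" if "\<bar>t\<bar> \<le> M" for t
  proof -
    have "dist (g t) (g 0) \<le> L * dist t 0" using that by (intro lipschitz_onD[OF L]) auto
    then have "\<bar>g t\<bar> / lam \<le> L * \<bar>t\<bar> / lam" using lam_pos by (intro divide_right_mono) auto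
    moreover have "\<bar>restoring t\<bar> \<le> \<bar>g t\<bar> / lam"
      using pucci_inv_lipschitz[OF lam_pos lam_le, of "- g t" 0] by (simp add: restoring_def pucci_inv_def)
    ultimately show ?thesis by (simp add: distrib_right)
  qed
  moreover have "0 < L / lam + 1" using L0 lam_pos by (simp add: add_nonneg_pos)
  ultimately show thesis using that by blast
qed

lemma potential_quadratic:
  assumes "\<And>t. \<bar>t\<bar> \<le> M \<Longrightarrow> c * t\<^sup>2 \<le> t * restoring t" "\<And>t. \<bar>t\<bar> \<le> M \<Longrightarrow> \<bar>restoring t\<bar> \<le> L * \<bar>t\<bar>"
    and "\<bar>t\<bar> \<le> M"
  shows "c / 2 * t\<^sup>2 \<le> potential t" "potential t \<le> L / 2 * t\<^sup>2"
proof -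
  have "potential 0 - c / 2 * 0\<^sup>2 \<le> potential t - c / 2 * t\<^sup>2"
  proof (rule nondecreasing_away_from_0[where F = "\<lambda>t. potential t - c / 2 * t\<^sup>2" and D = "\<lambda>t. restoring t - c * t" and M = M])
    show "((\<lambda>t. potential t - c / 2 * t\<^sup>2) has_real_derivative restoring x - c * x) (at x)" for x
      by (rule derivative_eq_intros potential_has_derivative refl)+ simp
    show "0 \<le> x * (restoring x - c * x)" if "\<bar>x\<bar> \<le> M" for x
      using assms(1)[OF that] by (simp add: right_diff_distrib power2_eq_square mult.left_commute)
  qed fact
  then show "c / 2 * t\<^sup>2 \<le> potential t" by simp
  have "L / 2 * 0\<^sup>2 - potential 0 \<le> L / 2 * t\<^sup>2 - potential t"
  proof (rule nondecreasing_away_from_0[where F = "\<lambda>t. L / 2 * t\<^sup>2 - potential t" and D = "\<lambda>t. L * t - restoring t" and M = M])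
    show "((\<lambda>t. L / 2 * t\<^sup>2 - potential t) has_real_derivative L * x - restoring x) (at x)" for x
      by (rule derivative_eq_intros potential_has_derivative refl)+ simp
    show "0 \<le> x * (L * x - restoring x)" if "\<bar>x\<bar> \<le> M" for x
      using assms(2)[OF that] by (auto simp: zero_le_mult_iff abs_le_iff abs_if split: if_splits)
  qed fact
  then show "potential t \<le> L / 2 * t\<^sup>2" by simp
qed

text \<open>The damping changes \<open>u''\<close> by at most \<open>(n Lam / lam) |u'| / r\<close>. In this form the inequality does not
  distinguish the signs of \<open>u\<close>, \<open>u'\<close> and \<open>u''\<close>.\<close>

lemma solution_pairing:
  assumes sol: "solves I u v w" and r: "r \<in> I" "0 < r" and c: "c * (u r)\<^sup>2 \<le> u r * restoring (u r)"
  shows "u r * w r \<le> - c * (u r)\<^sup>2 + (n * Lam / lam) / r * \<bar>u r * v r\<bar>"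
proof -
  have w: "w r = accel lam Lam n (v r / r) (g (u r))" using sol r by (simp add: radial_ode_def)
  have "\<bar>w r + restoring (u r)\<bar> \<le> n * Lam / lam * \<bar>v r / r - 0\<bar>"
    using accel_lipschitz_slope[OF lam_pos lam_le, of n "v r / r" "g (u r)" 0] n_pos
    by (simp add: w restoring_def accel_zero_slope)
  then have "\<bar>u r\<bar> * \<bar>w r + restoring (u r)\<bar> \<le> \<bar>u r\<bar> * (n * Lam / lam * \<bar>v r / r - 0\<bar>)"
    by (rule mult_left_mono) simp
  also have "\<dots> = (n * Lam / lam) / r * \<bar>u r * v r\<bar>"
    using r(2) by (simp add: abs_mult)
  finally have "\<bar>u r * (w r + restoring (u r))\<bar> \<le> (n * Lam / lam) / r * \<bar>u r * v r\<bar>"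
    by (simp only: abs_mult)
  then have "u r * (w r + restoring (u r)) \<le> (n * Lam / lam) / r * \<bar>u r * v r\<bar>" by linarith
  then show ?thesis using c by (simp add: distrib_left)
qed

lemma global_derivs:
  assumes "solves {0..} u v w" "0 < r"
  shows "(u has_real_derivative v r) (at r)" "(v has_real_derivative w r) (at r)"
  using radial_ode_deriv_interior[OF assms(1), of r] assms(2) by auto

theorem oscillation:
  assumes sol: "solves {0..} u v w" and M: "0 < M" "ereal M < \<alpha>" "\<And>r. 0 \<le> r \<Longrightarrow> \<bar>u r\<bar> \<le> M"
  shows "oscillating u"
proof -
  obtain c where c: "0 < c" "\<And>t. \<bar>t\<bar> \<le> M \<Longrightarrow> c * t\<^sup>2 \<le> t * restoring t" using restoring_coercive[OF M(1,2)] by blast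
  have zero: "\<exists>r\<ge>r1. u r = 0" if "0 < r1" for r1
  proof (rule linear_damping_forces_zero[OF c(1) _ that])
    show "0 \<le> n * Lam / lam" using n_pos lam_pos Lam_pos by simp
    fix r :: real assume r: "r1 \<le> r"
    then have "0 < r" using that by simp
    then show "(u has_real_derivative v r) (at r)" "(v has_real_derivative w r) (at r)"
      by (rule global_derivs[OF sol])+
    show "u r * w r \<le> - c * (u r)\<^sup>2 + n * Lam / lam / r * \<bar>u r * v r\<bar>"
      using \<open>0 < r\<close> by (intro solution_pairing[OF sol] c(2) M(3)) auto
  qed
  have "\<exists>r\<ge>real (Suc i). u r = 0" for i using zero[of "real (Suc i)"] by simp
  then obtain z where z: "\<And>i. real (Suc i) \<le> z i" "\<And>i. u (z i) = 0" by metis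
  have "\<not> bounded (range z)"
  proof
    assume "bounded (range z)"
    then obtain B where B: "\<forall>x\<in>range z. norm x \<le> B" unfolding bounded_iff by blast
    obtain i :: nat where "B < real i" using reals_Archimedean2 by blast
    also have "real i \<le> z i" using z(1)[of i] by simp
    also have "z i \<le> B" using bspec[OF B, of "z i"] by auto
    finally show False by simp
  qed
  moreover have "0 \<le> z i" for i using z(1)[of i] by simp
  ultimately show ?thesis unfolding oscillating_def using z(2) by blast
qed

end

section \<open>Decay\<close>

context radial_problem
begin

text \<open>Suppose \<open>E \<ge> e0\<close> throughout. The dissipation \<open>u'\<^sup>2/r\<close> alone might be small because \<open>u'\<close> is. Adding \<open>\<epsilon> u u'/r\<close> to
  the energy contributes \<open>\<epsilon> (u'\<^sup>2 + u u'')/r\<close>, whose second term is about \<open>- \<epsilon> c u\<^sup>2/r\<close>; the remaining terms are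
  of order \<open>|u u'|/r\<^sup>2\<close>. So the perturbed energy \<open>V\<close> decreases at least like \<open>- \<eta> ln r\<close>, although it is bounded
  below.\<close>

lemma energy_vanishes:
  assumes sol: "solves {0..} u v w" and M: "0 < M" "ereal M < \<alpha>" "\<And>r. 0 \<le> r \<Longrightarrow> \<bar>u r\<bar> \<le> M"
    and e0: "0 < e0"
  shows "\<exists>r\<ge>0. energy u v r < e0"
proof (rule ccontr)
  assume "\<not> (\<exists>r\<ge>0. energy u v r < e0)"
  then have large: "e0 \<le> energy u v r" if "0 \<le> r" for r using that by force
  obtain c where c: "0 < c" "\<And>t. \<bar>t\<bar> \<le> M \<Longrightarrow> c * t\<^sup>2 \<le> t * restoring t"
    using restoring_coercive[OF M(1,2)] by blast
  obtain L where L: "0 < L" "\<And>t. \<bar>t\<bar> \<le> M \<Longrightarrow> \<bar>restoring t\<bar> \<le> L * \<bar>t\<bar>"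
    using restoring_linear_bound by blast
  define k where "k = n * Lam / lam"
  \<comment> \<open>half of the dissipation rate, so that half of the dissipation remains\<close>
  define \<epsilon> where "\<epsilon> = n * lam / Lam / 2"
  define c1 where "c1 = min 1 c"
  define A where "A = max 1 L / 2"
  define \<eta> where "\<eta> = \<epsilon> * c1 / 2 * (e0 / A)"
  \<comment> \<open>beyond this point the terms of order \<open>|u u'|/r\<^sup>2\<close> are at most half of the gain \<open>\<epsilon> c1 (u\<^sup>2 + v\<^sup>2)/r\<close>\<close>
  define r1 where "r1 = max 1 ((k + 1) / c1)"
  define B where "B = \<epsilon> * (M\<^sup>2 + 2 * energy u v 0) / 2"
  define V where "V r = energy u v r + \<epsilon> * (u r * v r) / r" for r
  have pos: "0 < k" "0 < \<epsilon>" "0 < c1" "0 < A" "c1 \<le> 1" "c1 \<le> c"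
    using n_pos lam_pos Lam_pos c(1) by (auto simp: k_def \<epsilon>_def c1_def A_def)
  have \<eta>: "0 < \<eta>" using pos e0 by (simp add: \<eta>_def)
  have E_upper: "energy u v r \<le> A * ((u r)\<^sup>2 + (v r)\<^sup>2)" if "0 \<le> r" for r
  proof -
    have "potential (u r) \<le> L / 2 * (u r)\<^sup>2"
      by (rule potential_quadratic(2)[OF c(2) L(2) M(3)[OF that]])
    also have "\<dots> \<le> A * (u r)\<^sup>2" by (intro mult_right_mono) (auto simp: A_def)
    finally have "potential (u r) \<le> A * (u r)\<^sup>2" .
    moreover have "1 / 2 * (v r)\<^sup>2 \<le> A * (v r)\<^sup>2" by (intro mult_right_mono) (auto simp: A_def)
    ultimately show ?thesis by (simp add: energy_def distrib_left)
  qed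
  have uv: "2 * \<bar>u r * v r\<bar> \<le> (u r)\<^sup>2 + (v r)\<^sup>2" for r
    using sum_squares_bound[of "\<bar>u r\<bar>" "\<bar>v r\<bar>"] by (simp add: abs_mult)
  have dV: "\<exists>D. ((\<lambda>r. V r + \<eta> * ln r) has_real_derivative D) (at r) \<and> D \<le> 0" if r: "r1 \<le> r" for r
  proof -
    have r0: "0 < r" "1 \<le> r" "(k + 1) / c1 \<le> r" using r by (auto simp: r1_def)
    note d = global_derivs[OF sol r0(1)]
    define p where "p = \<bar>u r * v r\<bar>"
    define s where "s = (u r)\<^sup>2 + (v r)\<^sup>2"
    obtain D where D: "(energy u v has_real_derivative D) (at r)" "D \<le> - (n * lam / Lam) * (v r)\<^sup>2 / r"
      using energy_dissipation[OF sol, of r] r0 by auto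
    define D' where "D' = \<epsilon> * (((v r * v r + w r * u r) * r - u r * v r * 1) / (r * r))"
    have "((\<lambda>r. \<epsilon> * (u r * v r / r)) has_real_derivative D') (at r)"
      unfolding D'_def using r0(1) by (intro DERIV_cmult DERIV_divide DERIV_mult d DERIV_ident) simp
    then have dV: "((\<lambda>r. V r + \<eta> * ln r) has_real_derivative D + D' + \<eta> * (1 / r)) (at r)"
      unfolding V_def using r0(1) by (intro DERIV_add D(1) DERIV_cmult DERIV_ln_divide) simp_all
    have "u r * w r \<le> - c * (u r)\<^sup>2 + k / r * p"
      unfolding k_def p_def using r0 by (intro solution_pairing[OF sol] c(2) M(3)) auto
    moreover have "c1 * (u r)\<^sup>2 \<le> c * (u r)\<^sup>2" using pos by (intro mult_right_mono) auto
    ultimately have "u r * w r \<le> - c1 * (u r)\<^sup>2 + k / r * p" by simp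
    moreover have "- (u r * v r) / r \<le> p / r"
      unfolding p_def using r0(1) by (intro divide_right_mono) auto
    ultimately have 1: "(v r)\<^sup>2 + u r * w r - u r * v r / r \<le> (v r)\<^sup>2 - c1 * (u r)\<^sup>2 + (k + 1) / r * p"
      by (simp add: add_divide_distrib distrib_right)
    have "(k + 1) / r \<le> c1" using r0 pos by (simp add: field_simps)
    then have "(k + 1) / r * p \<le> c1 * p" by (intro mult_right_mono) (auto simp: p_def)
    also have "\<dots> \<le> c1 * (s / 2)" using uv[of r] pos by (intro mult_left_mono) (auto simp: p_def s_def)
    finally have 2: "(k + 1) / r * p \<le> c1 / 2 * s" by simp
    have "c1 * (v r)\<^sup>2 \<le> 1 * (v r)\<^sup>2" using pos by (intro mult_right_mono) auto
    with 1 2 have 3: "(v r)\<^sup>2 + u r * w r - u r * v r / r - 2 * (v r)\<^sup>2 \<le> - (c1 / 2) * s"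
      unfolding s_def by (simp add: distrib_left)
    have "D' = \<epsilon> / r * ((v r)\<^sup>2 + u r * w r - u r * v r / r)"
      using r0(1) by (simp add: D'_def field_simps power2_eq_square)
    moreover have "- (n * lam / Lam) * (v r)\<^sup>2 / r = \<epsilon> / r * (- 2 * (v r)\<^sup>2)" by (simp add: \<epsilon>_def)
    ultimately have "D + D' \<le> \<epsilon> / r * ((v r)\<^sup>2 + u r * w r - u r * v r / r - 2 * (v r)\<^sup>2)"
      using D(2) by (simp add: distrib_left right_diff_distrib)
    also have "\<dots> \<le> \<epsilon> / r * (- (c1 / 2) * s)"
      using 3 pos r0 by (intro mult_left_mono) auto
    also have "\<dots> \<le> \<epsilon> / r * (- (c1 / 2) * (e0 / A))"
    proof (rule mult_left_mono)
      have "e0 \<le> A * s" using large[of r] E_upper[of r] r0 by (simp add: s_def)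
      then have "e0 / A \<le> s" using pos by (simp add: pos_divide_le_eq mult.commute)
      then show "- (c1 / 2) * s \<le> - (c1 / 2) * (e0 / A)"
        by (rule mult_left_mono_neg) (use pos in simp)
    qed (use pos r0 in simp)
    also have "\<dots> = - (\<eta> * (1 / r))" by (simp add: \<eta>_def mult.commute mult.left_commute)
    finally show ?thesis using dV by (intro exI[of _ "D + D' + \<eta> * (1 / r)"]) simp
  qed
  have V_lower: "- B \<le> V r" if r: "1 \<le> r" for r
  proof -
    have "energy u v r \<le> energy u v 0"
      by (rule energy_antimono[OF sol]) (use r in auto)
    moreover have pot: "0 \<le> potential (u r)"
    proof -
      have "0 \<le> c / 2 * (u r)\<^sup>2" using c(1) by simp
      also have "\<dots> \<le> potential (u r)" by (rule potential_quadratic(1)[OF c(2) L(2) M(3)]) (use r in auto)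
      finally show ?thesis .
    qed
    ultimately have "(v r)\<^sup>2 \<le> 2 * energy u v 0" by (simp add: energy_def)
    moreover have "(u r)\<^sup>2 \<le> M\<^sup>2" using M(3)[of r] M(1) r by (simp add: abs_le_square_iff[symmetric])
    ultimately have "\<bar>u r * v r\<bar> \<le> (M\<^sup>2 + 2 * energy u v 0) / 2" using uv[of r] by simp
    then have "\<epsilon> * \<bar>u r * v r\<bar> \<le> \<epsilon> * ((M\<^sup>2 + 2 * energy u v 0) / 2)" using pos by (intro mult_left_mono) auto
    moreover have "\<epsilon> * \<bar>u r * v r\<bar> / r \<le> \<epsilon> * \<bar>u r * v r\<bar> / 1"
      using pos r by (intro divide_left_mono) auto
    moreover have "\<bar>\<epsilon> * (u r * v r) / r\<bar> = \<epsilon> * \<bar>u r * v r\<bar> / r" using pos r by (simp add: abs_mult)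
    ultimately have "\<bar>\<epsilon> * (u r * v r) / r\<bar> \<le> B" unfolding B_def by linarith
    moreover have "0 \<le> energy u v r" using pot by (simp add: energy_def)
    ultimately show ?thesis unfolding V_def by linarith
  qed
  define X where "X = (V r1 + \<eta> * ln r1 + B + 1) / \<eta>"
  define r where "r = max r1 (exp X)"
  have r: "r1 \<le> r" "exp X \<le> r" "1 \<le> r" by (auto simp: r_def r1_def)
  have "V r + \<eta> * ln r \<le> V r1 + \<eta> * ln r1"
    by (rule DERIV_nonpos_imp_nonincreasing[OF r(1) dV])
  moreover have "X \<le> ln r" using r by (simp add: ln_ge_iff)
  then have "\<eta> * X \<le> \<eta> * ln r" using \<eta> by simp
  moreover have "\<eta> * X = V r1 + \<eta> * ln r1 + B + 1" using \<eta> by (simp add: X_def)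
  ultimately show False using V_lower[OF r(3)] by linarith
qed

theorem decay:
  assumes sol: "solves {0..} u v w" and M: "0 < M" "ereal M < \<alpha>" "\<And>r. 0 \<le> r \<Longrightarrow> \<bar>u r\<bar> \<le> M"
  shows "(u \<longlongrightarrow> 0) at_top" "(v \<longlongrightarrow> 0) at_top" "(w \<longlongrightarrow> 0) at_top"
proof -
  obtain c where c: "0 < c" "\<And>t. \<bar>t\<bar> \<le> M \<Longrightarrow> c * t\<^sup>2 \<le> t * restoring t"
    using restoring_coercive[OF M(1,2)] by blast
  obtain L where L: "0 < L" "\<And>t. \<bar>t\<bar> \<le> M \<Longrightarrow> \<bar>restoring t\<bar> \<le> L * \<bar>t\<bar>"
    using restoring_linear_bound by blast
  have lower: "c / 2 * (u r)\<^sup>2 \<le> potential (u r)" if "0 \<le> r" for r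
    by (rule potential_quadratic(1)[OF c(2) L(2) M(3)[OF that]])
  have E0: "(energy u v \<longlongrightarrow> 0) at_top"
  proof (rule tendstoI)
    fix e :: real assume "0 < e"
    then obtain r0 where r0: "0 \<le> r0" "energy u v r0 < e" using energy_vanishes[OF sol M] by blast
    show "eventually (\<lambda>r. dist (energy u v r) 0 < e) at_top"
      using eventually_ge_at_top[of r0]
    proof eventually_elim
      case (elim r)
      have "energy u v r \<le> energy u v r0"
        by (rule energy_antimono[OF sol r0(1) elim]) (use r0 in auto)
      moreover have "0 \<le> c / 2 * (u r)\<^sup>2" using c(1) by simp
      then have "0 \<le> energy u v r" using lower[of r] r0(1) elim by (simp add: energy_def)
      ultimately show ?case using r0(2) by simp
    qed
  qed
  have ev: "eventually (\<lambda>r. 0 \<le> r) (at_top :: real filter)" by (rule eventually_ge_at_top)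
  have sqrt_lim: "(f \<longlongrightarrow> 0) at_top" if "eventually (\<lambda>r. C * (f r)\<^sup>2 \<le> energy u v r) at_top" "0 < C" for f C
  proof -
    have "((\<lambda>r. energy u v r / C) \<longlongrightarrow> 0 / C) at_top"
      by (rule tendsto_divide[OF E0 tendsto_const]) (use that(2) in simp)
    then have lim: "((\<lambda>r. energy u v r / C) \<longlongrightarrow> 0) at_top" by simp
    have upper: "eventually (\<lambda>r. (f r)\<^sup>2 \<le> energy u v r / C) at_top"
      using that(1) by eventually_elim (use that(2) in \<open>simp add: pos_le_divide_eq mult.commute\<close>)
    have lower: "eventually (\<lambda>r. 0 \<le> (f r)\<^sup>2) at_top" by simp
    have "((\<lambda>r. (f r)\<^sup>2) \<longlongrightarrow> 0) at_top"
      by (rule tendsto_sandwich[OF lower upper tendsto_const lim])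
    then have "((\<lambda>r. sqrt ((f r)\<^sup>2)) \<longlongrightarrow> sqrt 0) at_top" by (rule tendsto_real_sqrt)
    then show ?thesis by (simp add: tendsto_rabs_zero_iff)
  qed
  show u0: "(u \<longlongrightarrow> 0) at_top"
  proof (rule sqrt_lim)
    show "eventually (\<lambda>r. c / 2 * (u r)\<^sup>2 \<le> energy u v r) at_top"
      using ev
    proof eventually_elim
      case (elim r)
      have "0 \<le> (v r)\<^sup>2 / 2" by simp
      with lower[OF elim] show ?case unfolding energy_def by linarith
    qed
  qed (use c(1) in simp)
  show v0: "(v \<longlongrightarrow> 0) at_top"
  proof (rule sqrt_lim)
    show "eventually (\<lambda>r. 1 / 2 * (v r)\<^sup>2 \<le> energy u v r) at_top"
      using ev
    proof eventually_elim
      case (elim r)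
      have "0 \<le> c / 2 * (u r)\<^sup>2" using c(1) by simp
      then show ?case using lower[of r] elim by (simp add: energy_def)
    qed
  qed simp
  have "((\<lambda>r. v r * inverse r) \<longlongrightarrow> 0 * 0) at_top"
    by (intro tendsto_mult v0 tendsto_inverse_0_at_top filterlim_ident)
  then have y0: "((\<lambda>r. v r / r) \<longlongrightarrow> 0) at_top" by (simp add: divide_inverse)
  have g_cont: "isCont g 0" using g_continuous by (simp add: continuous_on_eq_continuous_at)
  have "((\<lambda>r. g (u r)) \<longlongrightarrow> g 0) at_top"
    by (rule isCont_tendsto_compose[OF g_cont u0])
  then have g0: "((\<lambda>r. g (u r)) \<longlongrightarrow> 0) at_top" by simp
  have "isCont (\<lambda>p. accel lam Lam n (fst p) (snd p)) (0, 0)"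
  proof -
    have "continuous_on UNIV (\<lambda>p. accel lam Lam n (fst p) (snd p))"
      by (rule continuous_on_accel) (intro continuous_intros)+
    then show ?thesis by (simp add: continuous_on_eq_continuous_at)
  qed
  from isCont_tendsto_compose[where g = "\<lambda>p. accel lam Lam n (fst p) (snd p)", OF this tendsto_Pair[OF y0 g0]]
  have "((\<lambda>r. accel lam Lam n (v r / r) (g (u r))) \<longlongrightarrow> 0) at_top"
    by (simp add: accel_zero_slope pucci_inv_def)
  moreover have "eventually (\<lambda>r. accel lam Lam n (v r / r) (g (u r)) = w r) at_top"
    using eventually_gt_at_top[of 0]
  proof eventually_elim
    case (elim r)
    then show ?case by (intro radial_ode_equation[OF sol, symmetric]) auto
  qed
  ultimately show "(w \<longlongrightarrow> 0) at_top" by (rule Lim_transform_eventually)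
qed

end

section \<open>Radial functions and their norm\<close>

lemma norm_shift_axis:
  fixes x :: "real^'n::finite"
  shows "norm (x + t *\<^sub>R axis i 1) = sqrt ((norm x)\<^sup>2 + 2 * t * x $ i + t\<^sup>2)"
proof -
  have "(norm (x + t *\<^sub>R axis i 1))\<^sup>2 = (norm x)\<^sup>2 + 2 * t * x $ i + t\<^sup>2"
    unfolding power2_norm_eq_inner
    by (simp add: inner_add inner_axis inner_axis' power2_eq_square algebra_simps)
  then show ?thesis by (metis norm_ge_zero real_sqrt_unique)
qed

lemma norm_shift_derivative:
  fixes x :: "real^'n::finite"
  assumes "x \<noteq> 0"
  shows "((\<lambda>t. norm (x + t *\<^sub>R axis i 1)) has_real_derivative x $ i / norm x) (at 0)"
proof -
  have p: "0 < (norm x)\<^sup>2 + 2 * 0 * x $ i + 0\<^sup>2" using assms by simp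
  have "((\<lambda>t. (norm x)\<^sup>2 + 2 * t * x $ i + t\<^sup>2) has_real_derivative 2 * x $ i) (at 0)"
    by (auto intro!: derivative_eq_intros)
  from DERIV_chain2[OF DERIV_real_sqrt[OF p] this]
  show ?thesis unfolding norm_shift_axis by (simp add: field_simps)
qed

lemma filterlim_abs_at_0_right:
  "filterlim (\<lambda>t::real. \<bar>t\<bar>) (at 0 within {0..}) (at 0)"
  unfolding filterlim_at
proof
  show "eventually (\<lambda>t::real. \<bar>t\<bar> \<in> {0..} \<and> \<bar>t\<bar> \<noteq> 0) (at 0)"
    by (simp add: eventually_at_filter)
  show "((\<lambda>t::real. \<bar>t\<bar>) \<longlongrightarrow> 0) (at 0)" by (auto intro: tendsto_eq_intros)
qed

lemma derivative_at_0_limit: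
  assumes "(f has_real_derivative d) (at 0 within {0..})"
  shows "((\<lambda>t. (f \<bar>t\<bar> - f 0) / \<bar>t\<bar>) \<longlongrightarrow> d) (at 0)"
proof -
  have "((\<lambda>y. (f y - f 0) / y) \<longlongrightarrow> d) (at 0 within {0..})"
    using assms by (simp add: has_field_derivative_iff)
  from filterlim_compose[OF this filterlim_abs_at_0_right] show ?thesis .
qed

lemma abs_component_div_norm_le: "\<bar>x $ i / norm x\<bar> \<le> 1" for x :: "real^'n::finite"
  using component_le_norm_cart[of x i] by (simp add: divide_le_eq_1)

text \<open>The first and second partial derivatives of \<open>u(|x|)\<close> are \<open>v(\<rho>) x\<^sub>i/\<rho>\<close> and
  \<open>(w(\<rho>) - v(\<rho>)/\<rho>) x\<^sub>i x\<^sub>j/\<rho>\<^sup>2 + \<delta>\<^sub>i\<^sub>j v(\<rho>)/\<rho>\<close> with \<open>\<rho> = |x|\<close>, and \<open>v(\<rho>)/\<rho>\<close> extends to the origin with the value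
  \<open>w(0)\<close> because \<open>v(0) = 0\<close>.\<close>

theorem radial_localized:
  fixes u v w :: "real \<Rightarrow> real"
  assumes du: "\<And>r. 0 \<le> r \<Longrightarrow> (u has_real_derivative v r) (at r within {0..})"
    and dv: "\<And>r. 0 \<le> r \<Longrightarrow> (v has_real_derivative w r) (at r within {0..})" and v0: "v 0 = 0"
    and lim: "(u \<longlongrightarrow> 0) at_top" "(v \<longlongrightarrow> 0) at_top" "(w \<longlongrightarrow> 0) at_top"
  shows "localized (\<lambda>x :: real^'n::finite. u (norm x))"
proof -
  have at: "at r within {0..} = at r" if "0 < r" for r :: real
    by (rule at_within_interior) (use that in simp)
  have du': "(u has_real_derivative v r) (at r)" if "0 < r" for r using du[of r] at[OF that] that by simp
  have dv': "(v has_real_derivative w r) (at r)" if "0 < r" for r using dv[of r] at[OF that] that by simp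
  \<comment> \<open>at the origin \<open>0 / 0 = 0\<close> gives the correct value\<close>
  define D :: "'n \<Rightarrow> real^'n \<Rightarrow> real" where "D i x = v (norm x) / norm x * x $ i" for i x
  define H :: "'n \<Rightarrow> 'n \<Rightarrow> real^'n \<Rightarrow> real" where
    "H i j x = (if x = 0 then (if i = j then w 0 else 0)
       else (w (norm x) * (x $ j / norm x) * norm x - v (norm x) * (x $ j / norm x)) / (norm x * norm x) * x $ i
         + (if i = j then 1 else 0) * (v (norm x) / norm x))" for i j x
  have part1: "has_partial i (\<lambda>x. u (norm x)) (D i)" for i
    unfolding has_partial_def
  proof
    fix x :: "real^'n"
    show "((\<lambda>t. u (norm (x + t *\<^sub>R axis i 1))) has_real_derivative D i x) (at 0)"
    proof (cases "x = 0")
      case False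
      then have "(u has_real_derivative v (norm x)) (at (norm (x + 0 *\<^sub>R axis i 1)))" using du' by simp
      from DERIV_chain2[OF this norm_shift_derivative[OF False]]
      show ?thesis by (simp add: D_def)
    next
      case True
      have "((\<lambda>t. (u \<bar>t\<bar> - u 0) / \<bar>t\<bar>) \<longlongrightarrow> 0) (at 0)"
        using derivative_at_0_limit[OF du[of 0]] v0 by simp
      then have "((\<lambda>t. \<bar>(u \<bar>t\<bar> - u 0) / \<bar>t\<bar>\<bar>) \<longlongrightarrow> 0) (at 0)" by (rule tendsto_rabs_zero)
      then have "((\<lambda>t. \<bar>(u \<bar>t\<bar> - u 0) / t\<bar>) \<longlongrightarrow> 0) (at 0)" by (simp add: abs_divide)
      then have "((\<lambda>t. (u \<bar>t\<bar> - u 0) / t) \<longlongrightarrow> 0) (at 0)" by (rule tendsto_rabs_zero_cancel)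
      then show ?thesis using True by (simp add: has_field_derivative_iff D_def)
    qed
  qed
  have part2: "has_partial j (D i) (H i j)" for i j
    unfolding has_partial_def
  proof
    fix x :: "real^'n"
    have comp: "(x + t *\<^sub>R axis j 1) $ i = x $ i + t * (if i = j then 1 else 0)" for t
      by (simp add: axis_def)
    show "((\<lambda>t. D i (x + t *\<^sub>R axis j 1)) has_real_derivative H i j x) (at 0)"
    proof (cases "x = 0")
      case False
      let ?\<rho> = "\<lambda>t. norm (x + t *\<^sub>R axis j 1)"
      note d\<rho> = norm_shift_derivative[OF False, of j]
      have "(v has_real_derivative w (norm x)) (at (?\<rho> 0))" using dv' False by simp
      note dv\<rho> = DERIV_chain2[OF this d\<rho>]
      have lin: "((\<lambda>t. x $ i + t * (if i = j then 1 else 0)) has_real_derivative (if i = j then 1 else 0)) (at 0)"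
        by (auto intro!: derivative_eq_intros)
      have "?\<rho> 0 \<noteq> 0" using False by simp
      from DERIV_mult[OF DERIV_divide[OF dv\<rho> d\<rho> this] lin]
      show ?thesis unfolding D_def comp using False by (simp add: H_def)
    next
      case True
      have "((\<lambda>t. (v \<bar>t\<bar> - v 0) / \<bar>t\<bar>) \<longlongrightarrow> w 0) (at 0)"
        by (rule derivative_at_0_limit[OF dv]) simp
      then have "((\<lambda>t. v \<bar>t\<bar> / \<bar>t\<bar>) \<longlongrightarrow> w 0) (at 0)" using v0 by simp
      then have "((\<lambda>t. v \<bar>t\<bar> / \<bar>t\<bar> * (if i = j then 1 else 0)) \<longlongrightarrow> w 0 * (if i = j then 1 else 0)) (at 0)"
        by (rule tendsto_mult_right)
      then have "((\<lambda>t. (v \<bar>t\<bar> / \<bar>t\<bar> * (t * (if i = j then 1 else 0)) - 0) / (t - 0)) \<longlongrightarrow> w 0 * (if i = j then 1 else 0)) (at 0)"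
        by (rule Lim_transform_within[where d = 1]) auto
      moreover have "H i j x = w 0 * (if i = j then 1 else 0)" using True by (simp add: H_def)
      ultimately show ?thesis using True unfolding D_def comp has_field_derivative_iff by simp
    qed
  qed
  have norm_lim: "filterlim (norm :: real^'n \<Rightarrow> real) at_top at_infinity" by (rule filterlim_norm_at_top)
  note ulim = filterlim_compose[OF lim(1) norm_lim] and vlim = filterlim_compose[OF lim(2) norm_lim]
    and wlim = filterlim_compose[OF lim(3) norm_lim]
  have D_lim: "(D i \<longlongrightarrow> 0) at_infinity" for i
  proof (rule Lim_null_comparison[OF _ tendsto_rabs_zero[OF vlim]])
    have "norm (D i x) \<le> \<bar>v (norm x)\<bar>" for x
      using mult_left_mono[OF abs_component_div_norm_le[of x i], of "\<bar>v (norm x)\<bar>"]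
      by (simp add: D_def abs_mult)
    then show "eventually (\<lambda>x. norm (D i x) \<le> \<bar>v (norm x)\<bar>) at_infinity" by simp
  qed
  have H_lim: "(H i j \<longlongrightarrow> 0) at_infinity" for i j
  proof (rule Lim_null_comparison)
    show "((\<lambda>x :: real^'n. \<bar>w (norm x)\<bar> + 2 * \<bar>v (norm x)\<bar>) \<longlongrightarrow> 0) at_infinity"
      using tendsto_add[OF tendsto_rabs_zero[OF wlim] tendsto_mult_right_zero[OF tendsto_rabs_zero[OF vlim], of 2]] by simp
    have "norm (H i j x) \<le> \<bar>w (norm x)\<bar> + 2 * \<bar>v (norm x)\<bar>" if x: "1 \<le> norm x" for x
    proof -
      define \<rho> a b where "\<rho> = norm x" and "a = x $ i / norm x" and "b = x $ j / norm x"
      have \<rho>: "1 \<le> \<rho>" "x \<noteq> 0" using x by (auto simp: \<rho>_def)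
      have ab: "\<bar>a * b\<bar> \<le> 1"
        unfolding a_def b_def abs_mult by (intro mult_le_one abs_component_div_norm_le abs_ge_zero)
      have v: "\<bar>v \<rho> / \<rho>\<bar> \<le> \<bar>v \<rho>\<bar>"
      proof -
        have "\<bar>v \<rho>\<bar> / \<rho> \<le> \<bar>v \<rho>\<bar> / 1" using \<rho> by (intro divide_left_mono) auto
        then show ?thesis using \<rho> by (simp add: abs_divide)
      qed
      have "H i j x = w \<rho> * (a * b) - v \<rho> / \<rho> * (a * b) + (if i = j then 1 else 0) * (v \<rho> / \<rho>)"
        using \<rho> by (simp add: H_def \<rho>_def[symmetric] a_def b_def field_simps)
      moreover have "\<bar>w \<rho> * (a * b)\<bar> \<le> \<bar>w \<rho>\<bar>" "\<bar>v \<rho> / \<rho> * (a * b)\<bar> \<le> \<bar>v \<rho> / \<rho>\<bar>"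
        using mult_left_mono[OF ab, of "\<bar>w \<rho>\<bar>"] mult_left_mono[OF ab, of "\<bar>v \<rho> / \<rho>\<bar>"]
        by (simp_all add: abs_mult)
      moreover have "\<bar>(if i = j then 1 else 0) * (v \<rho> / \<rho>)\<bar> \<le> \<bar>v \<rho> / \<rho>\<bar>" by simp
      ultimately have "\<bar>H i j x\<bar> \<le> \<bar>w \<rho>\<bar> + 2 * \<bar>v \<rho>\<bar>" using v by linarith
      then show ?thesis by (simp add: \<rho>_def)
    qed
    then show "eventually (\<lambda>x. norm (H i j x) \<le> \<bar>w (norm x)\<bar> + 2 * \<bar>v (norm x)\<bar>) at_infinity"
      unfolding eventually_at_infinity by blast
  qed
  show ?thesis
    unfolding localized_def
  proof (intro conjI exI allI)
    show "((\<lambda>x :: real^'n. u (norm x)) \<longlongrightarrow> 0) at_infinity" by (rule ulim)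
  qed (rule part1 part2 D_lim H_lim)+
qed

lemma Linf_norm_le:
  assumes "continuous_on {0..} u" "\<And>r. 0 \<le> r \<Longrightarrow> \<bar>u r\<bar> \<le> M"
  shows "Linf_norm u \<le> ereal M"
  unfolding Linf_norm_def
proof (rule esssup_I)
  have "u \<in> borel_measurable (lebesgue_on {0..})"
    by (rule continuous_imp_measurable_on_sets_lebesgue[OF assms(1)]) simp
  then show "(\<lambda>r. ereal \<bar>u r\<bar>) \<in> borel_measurable (lebesgue_on {0..})" by measurable
  show "AE r in lebesgue_on {0..}. ereal \<bar>u r\<bar> \<le> ereal M"
    by (rule AE_I2) (use assms(2) in simp)
qed

text \<open>By continuity \<open>|u|\<close> is almost as large as \<open>|u(0)|\<close> on an interval \<open>[0, d/2]\<close>, which has positive measure.\<close>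

lemma Linf_norm_ge_initial:
  assumes "continuous_on {0..} u"
  shows "ereal \<bar>u 0\<bar> \<le> Linf_norm u"
proof (rule ccontr)
  assume "\<not> ereal \<bar>u 0\<bar> \<le> Linf_norm u"
  then have "Linf_norm u < ereal \<bar>u 0\<bar>" by simp
  from ereal_dense2[OF this] obtain z where z: "Linf_norm u < ereal z" "ereal z < ereal \<bar>u 0\<bar>" by blast
  have "0 < \<bar>u 0\<bar> - z" using z(2) by simp
  from assms[unfolded continuous_on_iff, rule_format, of 0, OF _ this]
  obtain d where d: "0 < d" "\<forall>x\<in>{0..}. dist x 0 < d \<longrightarrow> dist (u x) (u 0) < \<bar>u 0\<bar> - z" by auto
  have near: "Linf_norm u < ereal \<bar>u x\<bar>" if "x \<in> {0..d/2}" for x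
  proof -
    have "dist (u x) (u 0) < \<bar>u 0\<bar> - z" using d that by (auto simp: dist_real_def)
    then have "z < \<bar>u x\<bar>" by (auto simp: dist_real_def)
    then show ?thesis using z(1) by (metis less_ereal.simps(1) less_trans)
  qed
  let ?M = "lebesgue_on {0::real..}"
  have m: "(\<lambda>r. ereal \<bar>u r\<bar>) \<in> borel_measurable ?M"
  proof -
    have "u \<in> borel_measurable ?M"
      by (rule continuous_imp_measurable_on_sets_lebesgue[OF assms]) simp
    then show ?thesis by measurable
  qed
  have "emeasure ?M {0..d/2} \<le> emeasure ?M {r \<in> space ?M. Linf_norm u < ereal \<bar>u r\<bar>}"
  proof (rule emeasure_mono)
    show "{0..d/2} \<subseteq> {r \<in> space ?M. Linf_norm u < ereal \<bar>u r\<bar>}" using near by auto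
    show "{r \<in> space ?M. Linf_norm u < ereal \<bar>u r\<bar>} \<in> sets ?M" using m by measurable
  qed
  also have "\<dots> = 0" unfolding Linf_norm_def by (rule esssup_zero_measure)
  also have "emeasure ?M {0..d/2} = emeasure lborel {0..d/2}"
    by (subst emeasure_restrict_space) auto
  also have "\<dots> = ennreal (d / 2)" using d(1) by simp
  finally show False using d(1) by simp
qed

section \<open>Growth outside the potential well\<close>

text \<open>At a nonpositive minimum \<open>p > 0\<close> of \<open>y\<close> on \<open>[0,b]\<close> the derivative is positive, so \<open>y\<close> is smaller just to the
  left of \<open>p\<close>.\<close>

lemma forced_derivative_positive:
  fixes y z :: "real \<Rightarrow> real"
  assumes cont: "continuous_on {0..b} y" and d: "\<And>r. 0 < r \<Longrightarrow> r \<le> b \<Longrightarrow> (y has_real_derivative z r) (at r)"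
    and y0: "y 0 = 0" and forced: "\<And>r. 0 < r \<Longrightarrow> r \<le> b \<Longrightarrow> y r \<le> 0 \<Longrightarrow> 0 < z r" and b: "0 < b"
  shows "0 < y b"
proof (rule ccontr)
  assume neg: "\<not> 0 < y b"
  obtain m where m: "m \<in> {0..b}" "\<And>q. q \<in> {0..b} \<Longrightarrow> y m \<le> y q"
    using continuous_attains_inf[of "{0..b}" y] cont b by auto
  obtain p where p: "0 < p" "p \<le> b" "y p \<le> 0" "\<And>q. q \<in> {0..b} \<Longrightarrow> y p \<le> y q"
  proof (cases "m = 0")
    case True
    have "y b \<le> y q" if "q \<in> {0..b}" for q using m(2)[OF that] True y0 neg by simp
    then show thesis using neg b by (intro that[of b]) auto
  next
    case False
    have "y m \<le> 0" using m(2)[of 0] y0 b by simp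
    then show thesis using that[of m] m False by simp
  qed
  obtain e where e: "0 < e" "\<And>h. 0 < h \<Longrightarrow> h < e \<Longrightarrow> y (p - h) < y p"
    using DERIV_pos_inc_left[OF d[OF p(1,2)] forced[OF p(1-3)]] by blast
  define h where "h = min (e / 2) (p / 2)"
  have "0 < h" "h < e" "p - h \<in> {0..b}" using e(1) p(1,2) by (auto simp: h_def min_def field_simps)
  then show False using e(2)[of h] p(4)[of "p - h"] by simp
qed

text \<open>The combination \<open>r y + k x\<close> has derivative \<open>y + r z + k y \<ge> c r\<close>: the term \<open>k x\<close> absorbs the damping. So if \<open>x\<close> is
  bounded, \<open>r y\<close> grows quadratically, and then \<open>x\<close> is unbounded after all.\<close>

lemma forced_growth_unbounded:
  fixes x y z :: "real \<Rightarrow> real"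
  assumes k: "0 \<le> k" and c: "0 < c"
    and dx: "\<And>r. 0 < r \<Longrightarrow> (x has_real_derivative y r) (at r)"
    and dy: "\<And>r. 0 < r \<Longrightarrow> (y has_real_derivative z r) (at r)"
    and y: "\<And>r. 0 < r \<Longrightarrow> 0 \<le> y r" and z: "\<And>r. 0 < r \<Longrightarrow> c - k / r * y r \<le> z r"
  shows "\<exists>r>0. M < x r"
proof (rule ccontr)
  assume "\<not> (\<exists>r>0. M < x r)"
  then have bd: "x r \<le> M" if "0 < r" for r using that by force
  define Q where "Q r = r * y r + k * x r - c * r\<^sup>2 / 2" for r
  have Q: "Q 1 \<le> Q r" if "1 \<le> r" for r
  proof (rule DERIV_nonneg_imp_nondecreasing[OF that])
    fix s :: real assume s: "1 \<le> s" "s \<le> r"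
    then have s0: "0 < s" by simp
    have "((\<lambda>r. c * r\<^sup>2 / 2) has_real_derivative c * s) (at s)"
      by (auto intro!: derivative_eq_intros)
    then have "(Q has_real_derivative (1 * y s + z s * s + k * y s - c * s)) (at s)"
      unfolding Q_def
      by (intro DERIV_diff DERIV_add DERIV_mult DERIV_cmult DERIV_ident dx dy s0)
    moreover have "s * (c - k / s * y s) \<le> s * z s" using z[OF s0] s0 by (intro mult_left_mono) auto
    then have "c * s - k * y s \<le> z s * s" using s0 by (simp add: algebra_simps)
    ultimately show "\<exists>D. (Q has_real_derivative D) (at s) \<and> 0 \<le> D"
      using y[OF s0] by (intro exI[of _ "1 * y s + z s * s + k * y s - c * s"]) simp
  qed
  define C where "C = k * M - Q 1"
  \<comment> \<open>from here on \<open>c r\<^sup>2/2 - C \<ge> r\<close>\<close>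
  define r2 where "r2 = max 1 (2 * (1 + \<bar>C\<bar>) / c)"
  have y1: "1 \<le> y r" if r: "r2 \<le> r" for r
  proof -
    have r1: "1 \<le> r" "2 * (1 + \<bar>C\<bar>) / c \<le> r" using r by (auto simp: r2_def)
    have "k * x r \<le> k * M" using bd[of r] r1 k by (intro mult_left_mono) auto
    then have 1: "c * r\<^sup>2 / 2 - C \<le> r * y r" using Q[OF r1(1)] by (simp add: C_def Q_def)
    have "1 + \<bar>C\<bar> \<le> c * r / 2" using r1(2) c by (simp add: pos_divide_le_eq algebra_simps)
    then have "(1 + \<bar>C\<bar>) * r \<le> c * r / 2 * r" using r1 by (intro mult_right_mono) auto
    moreover have "\<bar>C\<bar> * 1 \<le> \<bar>C\<bar> * r" using r1 by (intro mult_left_mono) auto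
    ultimately have "r * 1 \<le> r * y r" using 1 by (simp add: power2_eq_square algebra_simps)
    then show ?thesis using r1 by simp
  qed
  define r where "r = r2 + (M - x r2 + 1)"
  have r2: "0 < r2" by (simp add: r2_def)
  have r: "r2 \<le> r" using bd[OF r2] by (simp add: r_def)
  have "x r2 - r2 \<le> x r - r"
  proof (rule DERIV_nonneg_imp_nondecreasing[OF r])
    fix s assume s: "r2 \<le> s" "s \<le> r"
    then have "((\<lambda>r. x r - r) has_real_derivative y s - 1) (at s)"
      using r2 by (intro DERIV_diff dx DERIV_ident) simp
    then show "\<exists>D. ((\<lambda>r. x r - r) has_real_derivative D) (at s) \<and> 0 \<le> D"
      using y1[OF s(1)] by (intro exI[of _ "y s - 1"]) simp
  qed
  then have "M < x r" by (simp add: r_def)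
  then show False using bd[of r] r r2 by simp
qed

context radial_problem
begin

lemma potential_antimono_beyond:
  assumes "\<alpha> \<le> ereal s" "s < t"
  shows "potential t < potential s" "potential (- t) < potential (- s)"
proof -
  have neg: "g x < 0" if "s < x" for x
  proof -
    have "\<alpha> < ereal x" by (rule le_less_trans[OF assms(1)]) (use that in simp)
    then show ?thesis by (rule g_neg)
  qed
  show "potential t < potential s"
  proof (rule DERIV_neg_imp_decreasing_open[OF assms(2)])
    fix x assume x: "s < x" "x < t"
    have "restoring x < 0"
      using neg[OF x(1)] restoring_nonpos_force[of x] lam_pos by (simp add: divide_neg_pos)
    then show "\<exists>y. (potential has_real_derivative y) (at x) \<and> y < 0"
      using potential_has_derivative by blast
  qed (rule continuous_potential)
  have "potential (- t) < potential (- s)"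
  proof (rule DERIV_pos_imp_increasing_open[of "- t" "- s"])
    fix x assume x: "- t < x" "x < - s"
    have "0 < g x" using neg[of "- x"] g_odd[of x] x by simp
    then have "0 < restoring x"
      using restoring_nonneg_force[of x] Lam_pos by simp
    then show "\<exists>y. (potential has_real_derivative y) (at x) \<and> 0 < y"
      using potential_has_derivative by blast
  qed (use assms(2) continuous_potential in auto)
  then show "potential (- t) < potential (- s)" .
qed

text \<open>The sign \<open>\<sigma>\<close> treats both sides of the well at once. On the way back the solution would pass through a
  point between \<open>\<alpha>\<close> and its starting height, where the potential exceeds the initial energy.\<close>

lemma no_return_inside:
  assumes sol: "solves (ivl R) u v w" and \<sigma>: "\<sigma> = 1 \<or> \<sigma> = - 1" and out: "\<alpha> < ereal (\<sigma> * u 0)" and r: "r \<in> ivl R"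
  shows "\<sigma> * u 0 \<le> \<sigma> * u r"
proof (rule ccontr)
  assume "\<not> \<sigma> * u 0 \<le> \<sigma> * u r"
  obtain a where a: "\<alpha> = ereal a" using \<alpha>_pos out by (cases \<alpha>) auto
  have r0: "0 \<le> r" using r by (simp add: ivl_def)
  have sub: "{0..r} \<subseteq> ivl R" using ivl_downward[OF r] by auto
  \<comment> \<open>a height on the way back that is still beyond \<open>\<alpha>\<close>\<close>
  define \<tau> where "\<tau> = max a (\<sigma> * u r)"
  have \<tau>: "\<sigma> * u r \<le> \<tau>" "\<tau> < \<sigma> * u 0" "\<alpha> \<le> ereal \<tau>"
    using \<open>\<not> \<sigma> * u 0 \<le> \<sigma> * u r\<close> out by (auto simp: \<tau>_def a)
  have "continuous_on {0..r} u"
    by (rule continuous_on_subset[OF radial_ode_continuous(1)[OF sol] sub])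
  then have "\<exists>x\<ge>0. x \<le> r \<and> - (\<sigma> * u x) = - \<tau>"
    using \<tau> r0 by (intro IVT'[where f = "\<lambda>x. - (\<sigma> * u x)"] continuous_intros) auto
  then obtain x where x: "0 \<le> x" "x \<le> r" "\<sigma> * u x = \<tau>" by auto
  have "potential (\<sigma> * (\<sigma> * u 0)) < potential (\<sigma> * \<tau>)"
    using potential_antimono_beyond[OF \<tau>(3,2)] \<sigma> by auto
  moreover have "\<sigma> * (\<sigma> * t) = t" for t using \<sigma> by auto
  ultimately have "potential (u 0) < potential (u x)" unfolding x(3)[symmetric] by simp
  also have "\<dots> \<le> energy u v x" by (simp add: energy_def)
  also have "\<dots> \<le> energy u v 0"
    by (rule energy_antimono[OF sol]) (use x sub in auto)
  also have "\<dots> = potential (u 0)" using sol by (simp add: energy_def radial_ode_def)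
  finally show False by simp
qed

text \<open>Damping opposes the motion. It weakens the outward force only while the solution moves outwards, hence
  the maximum with \<open>0\<close>; without it, \<open>forced_derivative_positive\<close> would not apply.\<close>

lemma outward_force:
  assumes sol: "solves I u v w" and r: "r \<in> I" "0 < r"
    and \<sigma>: "\<sigma> = 1 \<or> \<sigma> = - 1" and out: "\<alpha> < ereal (\<sigma> * u r)"
  shows "- g (\<sigma> * u r) / Lam - (n * Lam / lam) / r * max (\<sigma> * v r) 0 \<le> \<sigma> * w r"
proof -
  have g: "g (\<sigma> * u r) < 0" by (rule g_neg[OF out])
  let ?A = "\<lambda>y. accel lam Lam n y (g (u r))"
  have w: "w r = ?A (v r / r)" by (rule radial_ode_equation[OF sol r])
  have force: "- g (\<sigma> * u r) / Lam \<le> \<sigma> * ?A 0"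
    using \<sigma>
  proof
    assume "\<sigma> = 1"
    then have "?A 0 = - g (u r) / lam" using g by (simp add: accel_zero_slope pucci_inv_def)
    moreover have "- g (u r) / Lam \<le> - g (u r) / lam"
      using g lam_pos lam_le \<open>\<sigma> = 1\<close> by (intro divide_left_mono) auto
    ultimately show ?thesis using \<open>\<sigma> = 1\<close> by simp
  next
    assume "\<sigma> = - 1"
    then have "?A 0 = - g (u r) / Lam" using g g_odd[of "u r"] by (simp add: accel_zero_slope pucci_inv_def)
    then show ?thesis using \<open>\<sigma> = - 1\<close> g_odd[of "u r"] by simp
  qed
  have "\<sigma> * ?A 0 - (n * Lam / lam) / r * max (\<sigma> * v r) 0 \<le> \<sigma> * ?A (v r / r)"
  proof (cases "0 \<le> \<sigma> * v r")
    case True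
    have "\<bar>?A (v r / r) - ?A 0\<bar> \<le> n * Lam / lam * \<bar>v r / r - 0\<bar>"
      by (rule accel_lipschitz_slope[OF lam_pos lam_le]) (use n_pos in simp)
    also have "\<bar>v r / r - 0\<bar> = \<sigma> * v r / r" using True \<sigma> r(2) by auto
    finally have "\<bar>?A (v r / r) - ?A 0\<bar> \<le> (n * Lam / lam) / r * (\<sigma> * v r)" by simp
    moreover have "\<sigma> * ?A 0 - \<sigma> * ?A (v r / r) \<le> \<bar>?A (v r / r) - ?A 0\<bar>" using \<sigma> by auto
    ultimately show ?thesis using True by (simp add: max_def)
  next
    case False
    have *: "0 \<le> n * lam / Lam * t" if "0 \<le> t" for t using that n_pos lam_pos Lam_pos by simp
    have "\<sigma> * ?A 0 \<le> \<sigma> * ?A (v r / r)"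
      using \<sigma>
    proof
      assume "\<sigma> = 1"
      then have "v r / r \<le> 0" using False r(2) by (simp add: divide_le_0_iff)
      then show ?thesis
        using accel_antimono_bounds(1)[OF lam_pos lam_le _ \<open>v r / r \<le> 0\<close>, of n "g (u r)"] n_pos
          *[of "0 - v r / r"] \<open>\<sigma> = 1\<close> by simp
    next
      assume "\<sigma> = - 1"
      then have "0 \<le> v r / r" using False r(2) by simp
      then show ?thesis
        using accel_antimono_bounds(1)[OF lam_pos lam_le _ \<open>0 \<le> v r / r\<close>, of n "g (u r)"] n_pos
          *[of "v r / r - 0"] \<open>\<sigma> = - 1\<close> by simp
    qed
    then show ?thesis using False by (simp add: max_def)
  qed
  then show ?thesis using force w by simp
qed

text \<open>The solution never drops below its starting height, so the force always points outwards. Hence the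
  outward velocity is positive, and boundedness is excluded by \<open>forced_growth_unbounded\<close> if \<open>R = \<infinity>\<close> and by the
  blow-up alternative if \<open>R < \<infinity>\<close>.\<close>

theorem outward_growth:
  assumes sol: "solves (ivl R) u v w" and "0 < R" and out: "\<alpha> < ereal \<bar>u 0\<bar>"
    and blowup: "\<And>M. R < \<infinity> \<Longrightarrow> \<exists>r\<in>ivl R. M < \<bar>u r\<bar>"
  shows "strict_mono_on (ivl R) (\<lambda>r. \<bar>u r\<bar>)"
    and "filterlim (\<lambda>r. \<bar>u (real_of_ereal r)\<bar>) at_top (at_left R)"
proof -
  define \<sigma> :: real where "\<sigma> = (if 0 \<le> u 0 then 1 else - 1)"
  have \<sigma>: "\<sigma> = 1 \<or> \<sigma> = - 1" and out: "\<alpha> < ereal (\<sigma> * u 0)"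
    using out by (auto simp: \<sigma>_def abs_if)
  have "0 < ereal (\<sigma> * u 0)" using \<alpha>_pos out by (rule less_trans)
  then have pos: "0 < \<sigma> * u 0" by simp
  have stay: "\<sigma> * u 0 \<le> \<sigma> * u r" if "r \<in> ivl R" for r
    by (rule no_return_inside[OF sol \<sigma> out that])
  have out': "\<alpha> < ereal (\<sigma> * u r)" if "r \<in> ivl R" for r
    by (rule less_le_trans[OF out]) (use stay[OF that] in simp)
  have abs: "\<bar>u r\<bar> = \<sigma> * u r" if "r \<in> ivl R" for r
    using stay[OF that] pos \<sigma> by auto
  have d: "((\<lambda>r. \<sigma> * u r) has_real_derivative \<sigma> * v r) (at r)" "((\<lambda>r. \<sigma> * v r) has_real_derivative \<sigma> * w r) (at r)"
    if "r \<in> ivl R" "0 < r" for r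
    using radial_ode_deriv_interior[OF sol ivl_interior[OF that]] by (auto intro: DERIV_cmult)
  have sub: "{0..b} \<subseteq> ivl R" if "b \<in> ivl R" for b
    using ivl_downward[OF that] by auto
  have v_pos: "0 < \<sigma> * v b" if b: "b \<in> ivl R" "0 < b" for b
  proof (rule forced_derivative_positive[where y = "\<lambda>r. \<sigma> * v r" and z = "\<lambda>r. \<sigma> * w r"])
    show "continuous_on {0..b} (\<lambda>r. \<sigma> * v r)"
      by (rule continuous_on_mult_left)
        (rule continuous_on_subset[OF radial_ode_continuous(2)[OF sol] sub[OF b(1)]])
    show "\<sigma> * v 0 = 0" using sol by (simp add: radial_ode_def)
    fix r assume r: "0 < r" "r \<le> b"
    then have rR: "r \<in> ivl R" using sub[OF b(1)] by auto
    show "((\<lambda>r. \<sigma> * v r) has_real_derivative \<sigma> * w r) (at r)" by (rule d[OF rR r(1)])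
    assume "\<sigma> * v r \<le> 0"
    then have "- g (\<sigma> * u r) / Lam \<le> \<sigma> * w r"
      using outward_force[OF sol rR r(1) \<sigma> out'[OF rR]] by (simp add: max_def)
    moreover have "0 < - g (\<sigma> * u r) / Lam" using g_neg[OF out'[OF rR]] Lam_pos by (simp add: divide_neg_pos)
    ultimately show "0 < \<sigma> * w r" by linarith
  qed (rule b)
  have mono: "\<sigma> * u r < \<sigma> * u s" if rs: "r \<in> ivl R" "s \<in> ivl R" "r < s" for r s
  proof (rule DERIV_pos_imp_increasing_open[OF rs(3)])
    fix x assume x: "r < x" "x < s"
    then have "x \<in> ivl R" "0 < x" using rs ivl_downward[OF rs(2), of x] by (auto simp: ivl_def)
    then show "\<exists>y. ((\<lambda>r. \<sigma> * u r) has_real_derivative y) (at x) \<and> 0 < y"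
      using d v_pos by blast
  next
    have "{r..s} \<subseteq> ivl R" using rs(1) ivl_downward[OF rs(2)] by (auto simp: ivl_def)
    then show "continuous_on {r..s} (\<lambda>r. \<sigma> * u r)"
      by (intro continuous_on_mult_left) (rule continuous_on_subset[OF radial_ode_continuous(1)[OF sol]])
  qed
  then show sm: "strict_mono_on (ivl R) (\<lambda>r. \<bar>u r\<bar>)"
    by (auto simp: strict_mono_on_def abs)
  have unbounded: "\<exists>r\<in>ivl R. M < \<bar>u r\<bar>" for M
  proof (cases "R = \<infinity>")
    case False
    then have "R < \<infinity>" by simp
    then show ?thesis by (rule blowup)
  next
    case True
    have R: "r \<in> ivl R" if "0 \<le> r" for r using that by (simp add: ivl_def True)
    show ?thesis
    proof (rule ccontr)
      assume "\<not> ?thesis"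
      then have bd: "\<sigma> * u r \<le> M" if "0 \<le> r" for r using R[OF that] abs by force
      have "continuous_on {\<sigma> * u 0..M} (\<lambda>t. - g t / Lam)"
        using Lam_pos by (intro continuous_intros continuous_on_subset[OF g_continuous subset_UNIV]) simp
      moreover have "{\<sigma> * u 0..M} \<noteq> {}" using bd[of 0] by simp
      ultimately obtain m where m: "m \<in> {\<sigma> * u 0..M}" "\<And>t. t \<in> {\<sigma> * u 0..M} \<Longrightarrow> - g m / Lam \<le> - g t / Lam"
        using continuous_attains_inf[of "{\<sigma> * u 0..M}" "\<lambda>t. - g t / Lam"] by auto
      have "\<alpha> < ereal m" by (rule less_le_trans[OF out]) (use m(1) in simp)
      then have c: "0 < - g m / Lam" using g_neg[of m] Lam_pos by (simp add: divide_neg_pos)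
      have "\<exists>r>0. M < \<sigma> * u r"
      proof (rule forced_growth_unbounded[where k = "n * Lam / lam" and c = "- g m / Lam"
            and y = "\<lambda>r. \<sigma> * v r" and z = "\<lambda>r. \<sigma> * w r"])
        show "0 \<le> n * Lam / lam" using n_pos lam_pos Lam_pos by simp
        fix r :: real assume r: "0 < r"
        show "((\<lambda>r. \<sigma> * u r) has_real_derivative \<sigma> * v r) (at r)" "((\<lambda>r. \<sigma> * v r) has_real_derivative \<sigma> * w r) (at r)"
          using d[of r] R[of r] r by auto
        show v: "0 \<le> \<sigma> * v r" using v_pos[of r] R[of r] r by simp
        have "- g m / Lam \<le> - g (\<sigma> * u r) / Lam"
          by (rule m(2)) (use bd[of r] stay[of r] R[of r] r in simp)
        then show "- g m / Lam - n * Lam / lam / r * (\<sigma> * v r) \<le> \<sigma> * w r"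
          using outward_force[OF sol R[OF less_imp_le[OF r]] r \<sigma> out'[OF R[OF less_imp_le[OF r]]]]
          unfolding max_absorb1[OF v] by linarith
      qed (rule c)
      then obtain r where "0 < r" "M < \<sigma> * u r" by blast
      then show False using bd[of r] by simp
    qed
  qed
  show "filterlim (\<lambda>r. \<bar>u (real_of_ereal r)\<bar>) at_top (at_left R)"
    unfolding filterlim_at_top
  proof
    fix M :: real
    obtain r0 where r0: "r0 \<in> ivl R" "M < \<bar>u r0\<bar>" using unbounded by blast
    have lt: "ereal r0 < R" using r0(1) by (simp add: ivl_def)
    have "M \<le> \<bar>u (real_of_ereal s)\<bar>" if s: "ereal r0 < s" "s < R" for s
    proof -
      obtain t where t: "s = ereal t" using s by (cases s) auto
      then have "t \<in> ivl R" "r0 < t" using s r0(1) by (auto simp: ivl_def)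
      then have "\<bar>u r0\<bar> < \<bar>u t\<bar>" using mono[OF r0(1)] abs r0(1) by simp
      then show ?thesis using r0(2) t by simp
    qed
    then show "eventually (\<lambda>s. M \<le> \<bar>u (real_of_ereal s)\<bar>) (at_left R)"
      unfolding eventually_at_left[OF lt] using lt by blast
  qed
qed

end

section \<open>The Cauchy problem\<close>

context radial_problem
begin

lemma g_zero_at_threshold:
  assumes "ereal a = \<alpha>"
  shows "g a = 0"
proof (rule antisym)
  have a: "0 < a" using \<alpha>_pos assms by (metis ereal_less(2))
  have lim: "(g \<longlongrightarrow> g a) (at a within S)" for S
    using g_continuous by (auto simp: continuous_on_def intro: tendsto_within_subset)
  show "g a \<le> 0"
    by (rule tendsto_upperbound[OF lim[of "{a<..}"]])
      (use g_neg assms in \<open>auto simp: eventually_at_filter less_imp_le\<close>)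
  have "eventually (\<lambda>t. t \<in> {0<..<a}) (at_left a)" by (rule eventually_at_leftI[OF _ a])
  then have "eventually (\<lambda>t. 0 \<le> g t) (at_left a)"
    by eventually_elim (use g_pos assms in \<open>force simp: less_imp_le\<close>)
  then show "0 \<le> g a" by (rule tendsto_lowerbound[OF lim]) simp
qed

lemma constant_solution:
  assumes "g \<xi> = 0"
  shows "solves I (\<lambda>_. \<xi>) (\<lambda>_. 0) (\<lambda>_. 0)"
  using assms by (auto simp: radial_ode_def accel_zero_slope pucci_inv_def)

lemma global_profile:
  assumes sol: "solves (ivl R) u v w" and R: "0 < R" 
    and blowup: "\<And>M. R < \<infinity> \<Longrightarrow> \<exists>r\<in>ivl R. M < \<bar>u r\<bar>"
    and M: "0 < M" "ereal M < \<alpha>" "\<And>r. r \<in> ivl R \<Longrightarrow> \<bar>u r\<bar> \<le> M"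
  shows "R = \<infinity> \<and> oscillating u \<and> localized (\<lambda>x :: real^'n::finite. u (norm x)) \<and> Linf_norm u \<le> ereal M"
proof -
  have "\<not> R < \<infinity>" using blowup[of M] M(3) by force
  then have R: "R = \<infinity>" by simp
  have ivl: "ivl R = {0..}" by (auto simp: ivl_def R)
  note sol = sol[unfolded ivl]
  have M': "\<bar>u r\<bar> \<le> M" if "0 \<le> r" for r using M(3) that by (simp add: ivl)
  have "oscillating u" by (rule oscillation[OF sol M(1,2) M'])
  moreover have "localized (\<lambda>x :: real^'n. u (norm x))"
    by (rule radial_localized[where v = v and w = w])
      (use sol decay[OF sol M(1,2) M'] in \<open>auto simp: radial_ode_def\<close>)
  moreover have "Linf_norm u \<le> ereal M"
    by (rule Linf_norm_le[OF radial_ode_continuous(1)[OF sol] M'])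
  ultimately show ?thesis using R by simp
qed

end

theorem theorem3p2:
  fixes lam Lam \<xi> :: real and g :: "real \<Rightarrow> real" and \<alpha> :: ereal
  assumes "0 < lam" and "lam \<le> Lam"
    and "2 \<le> CARD('n::finite)"
    and g1: "local_lipschitz (UNIV :: real set) UNIV (\<lambda>_. g)"
    and g2: "\<forall>t. g (- t) = - g t"
    and g3: "0 < \<alpha>"
      "\<forall>t. 0 < t \<and> ereal t < \<alpha> \<longrightarrow> 0 < g t"
      "\<forall>t. \<alpha> < ereal t \<longrightarrow> g t < 0"
    and g4: "g field_differentiable at 0" "0 < deriv g 0"
  shows "\<exists>u R. maximal_cauchy_solution lam Lam CARD('n) g \<xi> R u \<and>
    (ereal \<bar>\<xi>\<bar> = \<alpha> \<or> \<xi> = 0 \<longrightarrow> (\<forall>r\<in>ivl R. u r = \<xi>)) \<and>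
    (\<alpha> < ereal \<bar>\<xi>\<bar> \<longrightarrow>
       strict_mono_on (ivl R) (\<lambda>r. \<bar>u r\<bar>) \<and>
       filterlim (\<lambda>r. \<bar>u (real_of_ereal r)\<bar>) at_top (at_left R)) \<and>
    (0 < \<xi> \<and> ereal \<xi> < \<alpha> \<longrightarrow>
       R = \<infinity> \<and> oscillating u \<and> localized (\<lambda>x :: real^'n. u (norm x)) \<and>
       Linf_norm u = ereal \<xi> \<and> ereal \<xi> < \<alpha>) \<and>
    (- \<alpha> < ereal \<xi> \<and> \<xi> < 0 \<and> ereal (Lam * primitive g \<xi>) \<le> ereal lam * primitive_ext g \<alpha> \<longrightarrow>
       R = \<infinity> \<and> oscillating u \<and> localized (\<lambda>x :: real^'n. u (norm x)) \<and>
       Linf_norm u < \<alpha>)"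
proof -
  define n where "n = real CARD('n) - 1"
  interpret radial_problem lam Lam n g \<alpha>
    by unfold_locales (use assms in \<open>auto simp: n_def\<close>)
  note lam = lam_pos lam_le
  show ?thesis
  proof (cases "ereal \<bar>\<xi>\<bar> = \<alpha> \<or> \<xi> = 0")
    case True
    then have "g \<bar>\<xi>\<bar> = 0" using g_zero_at_threshold by auto
    then have "g \<xi> = 0" using g_odd[of \<xi>] by (cases "0 \<le> \<xi>") auto
    then have "solves (ivl \<infinity>) (\<lambda>_. \<xi>) (\<lambda>_. 0) (\<lambda>_. 0)" by (rule constant_solution)
    then have "maximal_cauchy_solution lam Lam CARD('n) g \<xi> \<infinity> (\<lambda>_. \<xi>)"
      unfolding n_def by (rule unbounded_solution_maximal[OF lam, rotated]) simp_all
    then show ?thesis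
      using True \<alpha>_pos by (intro exI[of _ "\<lambda>_. \<xi>"] exI[of _ \<infinity>]) (cases \<alpha>; auto)
  next
    case False
    obtain R u v w where R: "0 < R" and sol: "solves (ivl R) u v w" and u0: "u 0 = \<xi>"
      and blowup: "\<And>M. R < \<infinity> \<Longrightarrow> \<exists>r\<in>ivl R. M < \<bar>u r\<bar>"
      using maximal_radial_solution[OF lam less_imp_le[OF n_pos] g_lipschitz, of \<xi>] by blast
    have max: "maximal_cauchy_solution lam Lam CARD('n) g \<xi> R u"
      by (rule unbounded_solution_maximal[OF lam R sol[unfolded n_def] u0 blowup])
    have ii: "strict_mono_on (ivl R) (\<lambda>r. \<bar>u r\<bar>) \<and> filterlim (\<lambda>r. \<bar>u (real_of_ereal r)\<bar>) at_top (at_left R)"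
      if "\<alpha> < ereal \<bar>\<xi>\<bar>"
      using outward_growth[OF sol R _ blowup] that u0 by blast
    have iii: "R = \<infinity> \<and> oscillating u \<and> localized (\<lambda>x :: real^'n. u (norm x)) \<and> Linf_norm u = ereal \<xi>"
      if \<xi>: "0 < \<xi>" "ereal \<xi> < \<alpha>"
    proof -
      have "\<bar>u r\<bar> \<le> \<xi>" if "r \<in> ivl R" for r
        using amplitude_bounded_by_positive_start[OF sol R _ _ that] \<xi> u0 by simp
      from global_profile[OF sol R blowup \<xi> this, where 'n = 'n]
      have *: "R = \<infinity>" "oscillating u" "localized (\<lambda>x :: real^'n. u (norm x))" "Linf_norm u \<le> ereal \<xi>"
        by blast+
      have "ivl R = {0..}" by (auto simp: ivl_def *(1))
      then have "ereal \<bar>u 0\<bar> \<le> Linf_norm u"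
        using radial_ode_continuous(1)[OF sol] by (intro Linf_norm_ge_initial) simp
      then have "Linf_norm u = ereal \<xi>" using *(4) u0 \<xi>(1) by (intro antisym) simp_all
      with * show ?thesis by blast
    qed
    have iv: "R = \<infinity> \<and> oscillating u \<and> localized (\<lambda>x :: real^'n. u (norm x)) \<and> Linf_norm u < \<alpha>"
      if \<xi>: "- \<alpha> < ereal \<xi>" "\<xi> < 0" "ereal (Lam * primitive g \<xi>) \<le> ereal lam * primitive_ext g \<alpha>"
    proof -
      have small: "ereal (- \<xi>) < \<alpha>" using \<xi>(1) by (cases \<alpha>) auto
      have "potential \<xi> = primitive g \<xi> / lam"
        by (rule potential_eq_neg) (use \<xi>(2) small in auto)
      then have "ereal lam * ereal (Lam * potential \<xi>) \<le> ereal lam * primitive_ext g \<alpha>"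
        using \<xi>(3) lam_pos by simp
      then have "ereal (Lam * potential (u 0)) \<le> primitive_ext g \<alpha>"
        using lam_pos u0 by (cases "primitive_ext g \<alpha>") auto
      then obtain M where M: "0 < M" "ereal M < \<alpha>" "\<And>r. r \<in> ivl R \<Longrightarrow> \<bar>u r\<bar> \<le> M"
        using trapped_from_below[OF sol R] small \<xi>(2) u0 by auto
      from global_profile[OF sol R blowup M, where 'n = 'n]
      show ?thesis using M(2) by (auto intro: le_less_trans)
    qed
    show ?thesis
      using max ii iii iv False by blast
  qed
qed

end
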